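(* For every $\delta\in(0,1)$ there is a constant $C=C(\delta)$, independent of dimensions, such that for all $n\le N$ a random $n$-dimensional subspace $E$ of $M_N$ satisfies, with probability at least $1-\delta$, $$\pi_{1,cb}(\mathrm{id}_E)\le C,$$ i.e. $E$ is 1-summing with constant depending on the probability but not on the dimension.
   Context: $M_N$ is the operator space (C*-algebra) of complex $N\times N$ matrices, $E\subset M_N$ carries the induced operator space structure. A random $n$-dimensional subspace of $M_N$ is $E=\mathrm{span}\{U(y_1),\dots,U(y_n)\}$, where $U$ is distributed according to normalized Haar measure on the unitary group of the $N^2$-dimensional Hilbert space $M_N$ with inner product $\langle x,y\rangle=\mathrm{tr}(x^*y)$, and $y_1,\dots,y_n$ are $n$ distinct matrix units of $M_N$. For an operator space $E$ and an operator $T:E\to F$ into a Banach space, $\pi_{1,cb}(T)=\sup\{\sum_{k=1}^m\|Tu(e_k)\|:\ m\in\mathbb N,\ \|u:\ell_\infty^m\to E\|_{cb}\le1\}$; $T$ is 1-summing if this is finite, and $E$ is 1-summing if $\mathrm{id}_E$ is. *)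

theory Defs
  imports
    "HOL-Probability.Probability"
    "Jordan_Normal_Form.Matrix"
    "Jordan_Normal_Form.Schur_Decomposition"
begin

section \<open>Matrices\<close>

text \<open>The space $M_N$ is \<open>carrier_mat N N\<close>; matrices with explicit carriers are used because the
  constant in the theorem must not depend on \<open>N\<close>.\<close>

definition vec_l2norm :: "complex Matrix.vec \<Rightarrow> real" where
  "vec_l2norm v = sqrt (\<Sum>i<dim_vec v. (cmod (vec_index v i))\<^sup>2)"

definition opnorm :: "complex mat \<Rightarrow> real" where
  "opnorm A = Sup {vec_l2norm (A *\<^sub>v v) | v. v \<in> carrier_vec (dim_col A) \<and> vec_l2norm v \<le> 1}"

definition mat_trace :: "complex mat \<Rightarrow> complex" where
  "mat_trace A = (\<Sum>i<dim_row A. A $$ (i, i))"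

definition tr_inner :: "complex mat \<Rightarrow> complex mat \<Rightarrow> complex" where
  "tr_inner x y = mat_trace (mat_adjoint x * y)"

definition mat_unit :: "nat \<Rightarrow> nat \<Rightarrow> nat \<Rightarrow> complex mat" where
  "mat_unit N i j = mat N N (\<lambda>(k, l). if k = i \<and> l = j then 1 else 0)"

definition matrix_units :: "nat \<Rightarrow> complex mat set" where
  "matrix_units N = {mat_unit N i j | i j. i < N \<and> j < N}"

definition mat_linear_on :: "complex mat set \<Rightarrow> (complex mat \<Rightarrow> complex mat) \<Rightarrow> bool" where
  "mat_linear_on E u \<longleftrightarrow>
     (\<forall>x\<in>E. \<forall>y\<in>E. u (x + y) = u x + u y) \<and> (\<forall>a. \<forall>x\<in>E. u (a \<cdot>\<^sub>m x) = a \<cdot>\<^sub>m u x)"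

definition mat_span :: "nat \<Rightarrow> nat \<Rightarrow> (nat \<Rightarrow> complex mat) \<Rightarrow> complex mat set" where
  "mat_span N n x = {mat N N (\<lambda>ij. \<Sum>k<n. c k * x k $$ ij) | c. True}"


section \<open>Operator spaces, completely bounded norm, 1-summing norm\<close>

text \<open>A (finite-dimensional, concrete) operator space is a linear subspace \<open>E\<close> of $M_p$. An element
  of $M_r(E)$ is a family \<open>x i j \<in> E\<close> (\<open>i, j < r\<close>), and its norm is the operator norm of the block
  matrix \<open>block_mat r p x\<close> in $M_r(M_p) = M_{rp}$.\<close>

definition block_mat :: "nat \<Rightarrow> nat \<Rightarrow> (nat \<Rightarrow> nat \<Rightarrow> complex mat) \<Rightarrow> complex mat" where
  "block_mat r p x =
     mat (r * p) (r * p) (\<lambda>(a, b). x (a div p) (b div p) $$ (a mod p, b mod p))"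

text \<open>\<open>cb_norm p E q u\<close> is the cb norm of a linear map \<open>u\<close> from the subspace \<open>E\<close> of $M_p$ to $M_q$.\<close>

definition cb_norm ::
  "nat \<Rightarrow> complex mat set \<Rightarrow> nat \<Rightarrow> (complex mat \<Rightarrow> complex mat) \<Rightarrow> ennreal" where
  "cb_norm p E q u =
     Sup {ennreal (opnorm (block_mat r q (\<lambda>i j. u (x i j)))) | r x.
            (\<forall>i<r. \<forall>j<r. x i j \<in> E) \<and> opnorm (block_mat r p x) \<le> 1}"

text \<open>The operator space structure of the C*-algebra $\ell_\infty^m$ is that of the diagonal
  matrices in $M_m$; its \<open>k\<close>-th unit vector is \<open>mat_unit m k k\<close>.\<close>

definition linf :: "nat \<Rightarrow> complex mat set" where
  "linf m = {d \<in> carrier_mat m m. diagonal_mat d}"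

text \<open>\<open>pi_1cb N E nrm T\<close> is the norm $\pi_{1,cb}(T)$ of an operator \<open>T\<close> from the subspace \<open>E\<close> of $M_N$
  to a space with norm \<open>nrm\<close>; the value is \<open>\<infinity>\<close> if \<open>T\<close> is not 1-summing.\<close>

definition pi_1cb ::
  "nat \<Rightarrow> complex mat set \<Rightarrow> ('f \<Rightarrow> real) \<Rightarrow> (complex mat \<Rightarrow> 'f) \<Rightarrow> ennreal" where
  "pi_1cb N E nrm T =
     Sup {ennreal (\<Sum>k<m. nrm (T (u (mat_unit m k k)))) | m u.
            mat_linear_on (linf m) u \<and> u ` linf m \<subseteq> E \<and> cb_norm m (linf m) N u \<le> 1}"


section \<open>Haar measure on the unitary group of the Hilbert space $M_N$\<close>

definition unitary_ops :: "nat \<Rightarrow> (complex mat \<Rightarrow> complex mat) set" where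
  "unitary_ops N =
     {U \<in> carrier_mat N N \<rightarrow>\<^sub>E carrier_mat N N.
        mat_linear_on (carrier_mat N N) U \<and> U ` carrier_mat N N = carrier_mat N N \<and>
        (\<forall>x\<in>carrier_mat N N. \<forall>y\<in>carrier_mat N N. tr_inner (U x) (U y) = tr_inner x y)}"

text \<open>The entries \<open>(U(e\<^sub>k\<^sub>l))\<^sub>i\<^sub>j\<close> of \<open>U\<close>, padded by zeros, embed the unitary group homeomorphically
  into a product of copies of the complex plane; the Borel $\sigma$-algebra of the group is the pullback of the
  Borel $\sigma$-algebra of that product.\<close>

definition op_entries :: "nat \<Rightarrow> (complex mat \<Rightarrow> complex mat) \<Rightarrow> nat \<times> nat \<times> nat \<times> nat \<Rightarrow> complex"
  where "op_entries N U = (\<lambda>(i, j, k, l).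
     if i < N \<and> j < N \<and> k < N \<and> l < N then U (mat_unit N k l) $$ (i, j) else 0)"

definition unitary_borel :: "nat \<Rightarrow> (complex mat \<Rightarrow> complex mat) measure" where
  "unitary_borel N = vimage_algebra (unitary_ops N) (op_entries N) borel"

text \<open>\<open>compose (carrier_mat N N) V U\<close> is the group product \<open>V U\<close>. Normalized Haar measure is the unique
  left-invariant Borel probability measure.\<close>

definition normalized_haar :: "nat \<Rightarrow> (complex mat \<Rightarrow> complex mat) measure \<Rightarrow> bool" where
  "normalized_haar N \<mu> \<longleftrightarrow>
     prob_space \<mu> \<and> space \<mu> = unitary_ops N \<and> sets \<mu> = sets (unitary_borel N) \<and>
     (\<forall>V\<in>unitary_ops N. \<forall>A\<in>sets \<mu>.
        emeasure \<mu> (compose (carrier_mat N N) V ` A) = emeasure \<mu> A)"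

end

theory Submission
  imports Defs
begin

text \<open>Let $E = \mathrm{span}\{x_1,\dots,x_n\}$ with $x_k = U(y_k)$, and write $\|x\|$ for the operator norm and
  $\|x\|_2$ for the Hilbert--Schmidt norm of a matrix. The proof separates a deterministic statement
  about $E$ from a probabilistic one; the bridge is the inequality
  $$\sqrt N\,\|x\| \le K \|x\|_2 \quad (x \in E),$$
  which says that every element of $E$ has, up to a constant, the smallest operator norm that its
  Hilbert--Schmidt norm permits.

  This inequality implies $\pi_{1,cb}(\mathrm{id}_E) \le K^2$ (\<open>pi_1cb_le_of_opnorm_le_hs\<close>). If
  $u : \ell_\infty^m \to E$ is completely contractive and $a_l = u(e_l)$, then
  $\sum_l \bar b_l \otimes a_l$ is a contraction for all contractions $b_l$, because it is the image of
  the contraction $\sum_l \bar b_l \otimes e_l$ of $M_N(\ell_\infty^m)$. For $b_l = a_l / \|a_l\|$, testing on the maximally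
  entangled vector $N^{-1/2} \sum_i e_i \otimes e_i$ gives $\sum_l \|a_l\|_2^2 / \|a_l\| \le N$
  (\<open>sum_hs_sq_div_opnorm_le\<close>), and the inequality above bounds each summand below by
  $N \|a_l\| / K^2$. No factorization theorem for completely bounded maps enters.

  The inequality holds with probability at least $1 - \delta$ (\<open>random_subspace_opnorm_le_hs\<close>) by a
  union bound. Since $\|\sum_k c_k x_k\|_2 = \|c\|_2$, it is a bound by $K / \sqrt N$ on the trilinear form
  $(c, \xi, \eta) \mapsto \sum_{k,i,j} c_k \xi_i (x_k)_{ij} \eta_j$ in at most $N$ variables per slot. Nets with
  exponentially many points in $N$ suffice for the three slots (\<open>exists_net\<close>,
  \<open>trilinear_net_le\<close>). For fixed unit vectors the value of the form is the inner product of a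
  fixed unit vector $z$ with a uniformly distributed unit vector of the $N^2$-dimensional space $M_N$,
  and it exceeds $t$ in modulus with probability at most $4 e^{-t^2 N^2 / 8}$ (\<open>haar_tail\<close>). With
  $t^2$ a large multiple of $1/N$ this beats the size of the nets.

  The tail bound uses only that the measure is invariant under left multiplication by reflections:
  these move $z$ to any vector of the same norm, in particular to each of the
  $2^{N^2}$ vectors with entries $\pm \|z\|_2 / N$. Averaging over these signs turns the probability over $U$ into a
  probability over independent signs for fixed $U$, which Hoeffding's inequality controls.

  Finally, the measure of a set that is not measurable would be $0$ by convention, so the event
  itself has to be shown measurable (\<open>pi_1cb_sets\<close>); its complement is open in the entries of $U$.\<close>

section \<open>The operator norm and bilinear forms\<close>

definition l2 :: "nat \<Rightarrow> (nat \<Rightarrow> complex) \<Rightarrow> real" where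
  "l2 d f = L2_set (\<lambda>i. cmod (f i)) {..<d}"

text \<open>There is no conjugation: only absolute values of the form are used, and conjugating a test vector
  does not change its norm.\<close>

definition bil :: "complex mat \<Rightarrow> (nat \<Rightarrow> complex) \<Rightarrow> (nat \<Rightarrow> complex) \<Rightarrow> complex" where
  "bil A \<xi> \<eta> = (\<Sum>i<dim_row A. \<Sum>j<dim_col A. \<xi> i * A $$ (i, j) * \<eta> j)"

lemma l2_nonneg [simp]: "0 \<le> l2 d f"
  by (simp add: l2_def)

lemma l2_sq: "(l2 d f)\<^sup>2 = (\<Sum>i<d. (cmod (f i))\<^sup>2)"
  by (simp add: l2_def L2_set_def sum_nonneg)

lemma l2_le_1_iff: "l2 d f \<le> 1 \<longleftrightarrow> (\<Sum>i<d. (cmod (f i))\<^sup>2) \<le> 1"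
  by (simp add: l2_def L2_set_def)

lemma l2_cong: "(\<And>i. i < d \<Longrightarrow> cmod (f i) = cmod (g i)) \<Longrightarrow> l2 d f = l2 d g"
  unfolding l2_def by (rule L2_set_cong) auto

lemma vec_l2norm_eq: "vec_l2norm v = l2 (dim_vec v) (($) v)"
  by (simp add: vec_l2norm_def l2_def L2_set_def)

lemma l2_eq_0D: "l2 d f = 0 \<Longrightarrow> i < d \<Longrightarrow> f i = 0"
  by (auto simp: l2_def L2_set_eq_0_iff)

lemma l2_scale: "l2 d (\<lambda>i. c * f i) = cmod c * l2 d f"
  by (simp add: l2_def norm_mult L2_set_right_distrib)

lemma cauchy_schwarz_l2: "cmod (\<Sum>i<d. f i * g i) \<le> l2 d f * l2 d g"
proof -
  have "cmod (\<Sum>i<d. f i * g i) \<le> (\<Sum>i<d. \<bar>cmod (f i)\<bar> * \<bar>cmod (g i)\<bar>)"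
    by (rule order_trans[OF norm_sum]) (simp add: norm_mult)
  also have "\<dots> \<le> l2 d f * l2 d g"
    unfolding l2_def by (rule L2_set_mult_ineq)
  finally show ?thesis .
qed

lemma sum_l2_mult_le:
  assumes "finite L"
  shows "(\<Sum>l\<in>L. l2 d (f l) * l2 e (g l))
    \<le> sqrt (\<Sum>l\<in>L. \<Sum>i<d. (cmod (f l i))\<^sup>2) * sqrt (\<Sum>l\<in>L. \<Sum>i<e. (cmod (g l i))\<^sup>2)"
proof -
  have "(\<Sum>l\<in>L. l2 d (f l) * l2 e (g l)) = (\<Sum>l\<in>L. \<bar>l2 d (f l)\<bar> * \<bar>l2 e (g l)\<bar>)"
    by simp
  also have "\<dots> \<le> L2_set (\<lambda>l. l2 d (f l)) L * L2_set (\<lambda>l. l2 e (g l)) L"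
    by (rule L2_set_mult_ineq)
  finally show ?thesis
    by (simp add: L2_set_def l2_sq)
qed

lemma bil_eq_rows: "bil A \<xi> \<eta> = (\<Sum>i<dim_row A. \<xi> i * (\<Sum>j<dim_col A. A $$ (i, j) * \<eta> j))"
  by (simp add: bil_def sum_distrib_left mult.assoc)

lemma mult_mat_vec_index:
  assumes "v \<in> carrier_vec (dim_col A)" "i < dim_row A"
  shows "(A *\<^sub>v v) $ i = (\<Sum>j<dim_col A. A $$ (i, j) * v $ j)"
  using assms by (auto simp: scalar_prod_def atLeast0LessThan intro!: sum.cong)

lemma bil_mult_mat_vec:
  assumes "v \<in> carrier_vec (dim_col A)"
  shows "bil A \<xi> (($) v) = (\<Sum>i<dim_row A. \<xi> i * (A *\<^sub>v v) $ i)"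
  unfolding bil_eq_rows using assms by (intro sum.cong) (auto simp: mult_mat_vec_index simp del: index_mult_mat_vec)

text \<open>The Frobenius norm bounds the operator norm, so the supremum in \<^const>\<open>opnorm\<close> is a real
  one rather than a default value.\<close>

lemma bdd_above_opnorm:
  "bdd_above {vec_l2norm (A *\<^sub>v v) | v. v \<in> carrier_vec (dim_col A) \<and> vec_l2norm v \<le> 1}"
proof (rule bdd_aboveI, clarify)
  fix v assume v: "v \<in> carrier_vec (dim_col A)" "vec_l2norm v \<le> 1"
  have "vec_l2norm (A *\<^sub>v v) \<le> L2_set (\<lambda>i. l2 (dim_col A) (\<lambda>j. A $$ (i, j))) {..<dim_row A}"
    unfolding vec_l2norm_eq l2_def
  proof (simp, rule L2_set_mono)
    fix i assume i: "i \<in> {..<dim_row A}"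
    have "cmod ((A *\<^sub>v v) $ i) \<le> l2 (dim_col A) (\<lambda>j. A $$ (i, j)) * l2 (dim_col A) (($) v)"
      using i v by (simp add: mult_mat_vec_index cauchy_schwarz_l2 del: index_mult_mat_vec)
    also have "\<dots> \<le> l2 (dim_col A) (\<lambda>j. A $$ (i, j)) * 1"
      using v by (intro mult_left_mono) (auto simp: vec_l2norm_eq)
    finally show "cmod ((A *\<^sub>v v) $ i) \<le> L2_set (\<lambda>j. cmod (A $$ (i, j))) {..<dim_col A}"
      by (simp add: l2_def)
  qed auto
  then show "vec_l2norm (A *\<^sub>v v)
      \<le> L2_set (\<lambda>i. l2 (dim_col A) (\<lambda>j. A $$ (i, j))) {..<dim_row A}" .
qed

lemma opnorm_nonneg: "0 \<le> opnorm A"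
proof -
  have "vec_l2norm (A *\<^sub>v 0\<^sub>v (dim_col A)) \<le> opnorm A"
    unfolding opnorm_def
    by (rule cSup_upper[OF _ bdd_above_opnorm])
       (auto simp: vec_l2norm_def intro!: exI[of _ "0\<^sub>v (dim_col A)"])
  then show ?thesis
    by (rule order_trans[rotated]) (simp add: vec_l2norm_eq)
qed

lemma bil_le_opnorm: "cmod (bil A \<xi> \<eta>) \<le> opnorm A * l2 (dim_row A) \<xi> * l2 (dim_col A) \<eta>"
proof (cases "l2 (dim_col A) \<eta> = 0")
  case True
  then have "bil A \<xi> \<eta> = 0"
    by (auto simp: bil_def l2_eq_0D[OF True] intro!: sum.neutral)
  then show ?thesis using True by simp
next
  case False
  define s where "s = l2 (dim_col A) \<eta>"
  have s: "s > 0" using False l2_nonneg[of "dim_col A" \<eta>] by (simp add: s_def del: l2_nonneg)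
  define v where "v = Matrix.vec (dim_col A) (\<lambda>j. (1 / of_real s) * \<eta> j)"
  have v: "v \<in> carrier_vec (dim_col A)" by (simp add: v_def)
  have "vec_l2norm v = l2 (dim_col A) (\<lambda>j. (1 / of_real s) * \<eta> j)"
    unfolding vec_l2norm_eq by (auto simp: v_def intro!: l2_cong)
  also have "\<dots> = 1"
    unfolding l2_scale using s by (simp add: s_def norm_divide)
  finally have v1: "vec_l2norm v = 1" .
  have "bil A \<xi> \<eta> = of_real s * bil A \<xi> (($) v)"
    unfolding bil_def sum_distrib_left using s by (intro sum.cong) (auto simp: v_def)
  then have "cmod (bil A \<xi> \<eta>) = s * cmod (\<Sum>i<dim_row A. \<xi> i * (A *\<^sub>v v) $ i)"
    using s v by (simp add: bil_mult_mat_vec norm_mult del: index_mult_mat_vec)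
  also have "\<dots> \<le> s * (l2 (dim_row A) \<xi> * vec_l2norm (A *\<^sub>v v))"
    using s cauchy_schwarz_l2[of \<xi> "($) (A *\<^sub>v v)" "dim_row A"]
    by (intro mult_left_mono) (auto simp: vec_l2norm_eq simp del: index_mult_mat_vec)
  also have "\<dots> \<le> s * (l2 (dim_row A) \<xi> * opnorm A)"
  proof (intro mult_left_mono)
    show "vec_l2norm (A *\<^sub>v v) \<le> opnorm A"
      unfolding opnorm_def using v v1 by (intro cSup_upper[OF _ bdd_above_opnorm]) auto
  qed (use s in auto)
  finally show ?thesis by (simp add: s_def mult_ac)
qed

text \<open>With the previous lemma this makes the operator norm the best constant of the bilinear form. The
  bound is tested on $\xi = \overline{Av}$, $\eta = v$.\<close>

lemma opnorm_le:
  assumes "\<And>\<xi> \<eta>. cmod (bil A \<xi> \<eta>) \<le> M * l2 (dim_row A) \<xi> * l2 (dim_col A) \<eta>" "0 \<le> M"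
  shows "opnorm A \<le> M"
  unfolding opnorm_def
proof (rule cSup_least)
  show "{vec_l2norm (A *\<^sub>v v) | v. v \<in> carrier_vec (dim_col A) \<and> vec_l2norm v \<le> 1} \<noteq> {}"
    by (auto simp: vec_l2norm_def intro!: exI[of _ "0\<^sub>v (dim_col A)"])
next
  fix s assume "s \<in> {vec_l2norm (A *\<^sub>v v) | v. v \<in> carrier_vec (dim_col A) \<and> vec_l2norm v \<le> 1}"
  then obtain v where v: "v \<in> carrier_vec (dim_col A)" "vec_l2norm v \<le> 1"
    and s: "s = vec_l2norm (A *\<^sub>v v)" by auto
  have s0: "0 \<le> s" by (simp add: s vec_l2norm_eq)
  have "complex_of_real (s\<^sup>2) = (\<Sum>i<dim_row A. cnj ((A *\<^sub>v v) $ i) * (A *\<^sub>v v) $ i)"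
    unfolding s vec_l2norm_eq l2_sq
    by (simp add: complex_norm_square mult.commute del: index_mult_mat_vec of_real_power)
  also have "\<dots> = bil A (\<lambda>i. cnj ((A *\<^sub>v v) $ i)) (($) v)"
    using v by (simp add: bil_mult_mat_vec)
  finally have "s\<^sup>2 = cmod (bil A (\<lambda>i. cnj ((A *\<^sub>v v) $ i)) (($) v))"
    by (metis abs_of_nonneg norm_of_real zero_le_power2)
  also have "\<dots> \<le> M * l2 (dim_row A) (\<lambda>i. cnj ((A *\<^sub>v v) $ i)) * l2 (dim_col A) (($) v)"
    by (rule assms)
  also have "l2 (dim_row A) (\<lambda>i. cnj ((A *\<^sub>v v) $ i)) = s"
    unfolding s vec_l2norm_eq by (simp add: l2_def del: index_mult_mat_vec)
  also have "M * s * l2 (dim_col A) (($) v) \<le> M * s * 1"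
    using v s0 assms(2) by (intro mult_left_mono) (auto simp: vec_l2norm_eq)
  finally have "s * s \<le> s * M" by (simp add: power2_eq_square mult_ac)
  then show "s \<le> M"
    using s0 assms(2) by (cases "s = 0") auto
qed

text \<open>Entrywise conjugation preserves the operator norm, because the test vectors can be conjugated as
  well.\<close>

lemma opnorm_cnj_bil_le:
  "cmod (\<Sum>i<dim_row A. \<Sum>j<dim_col A. \<xi> i * cnj (A $$ (i, j)) * \<eta> j)
    \<le> opnorm A * l2 (dim_row A) \<xi> * l2 (dim_col A) \<eta>"
proof -
  have "(\<Sum>i<dim_row A. \<Sum>j<dim_col A. \<xi> i * cnj (A $$ (i, j)) * \<eta> j)
      = cnj (bil A (\<lambda>i. cnj (\<xi> i)) (\<lambda>j. cnj (\<eta> j)))"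
    by (simp add: bil_def)
  then show ?thesis
    using bil_le_opnorm[of A "\<lambda>i. cnj (\<xi> i)" "\<lambda>j. cnj (\<eta> j)"] by (simp add: l2_def)
qed

lemma opnorm_le_sum_entries:
  assumes "A \<in> carrier_mat p q"
  shows "opnorm A \<le> (\<Sum>i<p. \<Sum>j<q. cmod (A $$ (i, j)))"
proof (rule opnorm_le)
  fix \<xi> \<eta> :: "nat \<Rightarrow> complex"
  have "cmod (bil A \<xi> \<eta>) \<le> (\<Sum>i<p. \<Sum>j<q. cmod (\<xi> i * A $$ (i, j) * \<eta> j))"
    unfolding bil_def using assms by (auto intro!: order_trans[OF norm_sum] sum_mono)
  also have "\<dots> \<le> (\<Sum>i<p. \<Sum>j<q. cmod (A $$ (i, j)) * (l2 p \<xi> * l2 q \<eta>))"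
  proof (intro sum_mono)
    fix i j assume "i \<in> {..<p}" "j \<in> {..<q}"
    then have "cmod (\<xi> i) \<le> l2 p \<xi>" "cmod (\<eta> j) \<le> l2 q \<eta>"
      unfolding l2_def by (auto intro!: member_le_L2_set)
    then have "cmod (\<xi> i) * cmod (\<eta> j) \<le> l2 p \<xi> * l2 q \<eta>"
      by (intro mult_mono) auto
    from mult_left_mono[OF this norm_ge_zero[of "A $$ (i, j)"]]
    show "cmod (\<xi> i * A $$ (i, j) * \<eta> j) \<le> cmod (A $$ (i, j)) * (l2 p \<xi> * l2 q \<eta>)"
      by (simp add: norm_mult mult_ac)
  qed
  finally show "cmod (bil A \<xi> \<eta>)
      \<le> (\<Sum>i<p. \<Sum>j<q. cmod (A $$ (i, j))) * l2 (dim_row A) \<xi> * l2 (dim_col A) \<eta>"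
    using assms by (simp add: sum_distrib_right mult.assoc)
qed (simp add: sum_nonneg)

section \<open>Block matrices\<close>

lemma sum_lessThan_mult: "(\<Sum>a<r * p. F a) = (\<Sum>i<r. \<Sum>k<p. F (i * p + k :: nat))"
  for F :: "nat \<Rightarrow> 'a::comm_monoid_add"
proof -
  have "(\<Sum>k<p. F (i * p + k)) = sum F {i * p..<i * p + p}" for i
    using sum.shift_bounds_nat_ivl[of F 0 "i * p" p] by (simp add: atLeast0LessThan add.commute)
  then show ?thesis by (simp add: sum.nat_group)
qed

lemma l2_sq_blocks: "(l2 (r * p) \<xi>)\<^sup>2 = (\<Sum>k<p. \<Sum>i<r. (cmod (\<xi> (i * p + k)))\<^sup>2)"
  unfolding l2_sq sum_lessThan_mult by (rule sum.swap)

lemma l2_block_le: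
  assumes "k < p"
  shows "l2 r (\<lambda>i. \<xi> (i * p + k)) \<le> l2 (r * p) \<xi>"
proof -
  have "(l2 r (\<lambda>i. \<xi> (i * p + k)))\<^sup>2 \<le> (l2 (r * p) \<xi>)\<^sup>2"
    unfolding l2_sq_blocks l2_sq[of r]
    using assms member_le_sum[of k "{..<p}" "\<lambda>k. \<Sum>i<r. (cmod (\<xi> (i * p + k)))\<^sup>2"]
    by (simp add: sum_nonneg)
  then show ?thesis by (rule power2_le_imp_le) simp
qed

lemma dim_block_mat [simp]: "dim_row (block_mat r p x) = r * p" "dim_col (block_mat r p x) = r * p"
  by (simp_all add: block_mat_def)

lemma block_index_less: "i < r \<Longrightarrow> k < p \<Longrightarrow> i * p + k < r * (p::nat)"
  using mult_le_mono1[of "Suc i" r p] by simp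

lemma bil_block_mat:
  "bil (block_mat r p x) \<xi> \<eta>
    = (\<Sum>i<r. \<Sum>j<r. \<Sum>k<p. \<Sum>l<p. \<xi> (i * p + k) * x i j $$ (k, l) * \<eta> (j * p + l))"
proof -
  have "bil (block_mat r p x) \<xi> \<eta>
      = (\<Sum>i<r. \<Sum>k<p. \<Sum>j<r. \<Sum>l<p. \<xi> (i * p + k) * x i j $$ (k, l) * \<eta> (j * p + l))"
    unfolding bil_def dim_block_mat sum_lessThan_mult
  proof (intro sum.cong refl)
    fix i k j l assume *: "i \<in> {..<r}" "k \<in> {..<p}" "j \<in> {..<r}" "l \<in> {..<p}"
    have "i * p + k < r * p" "j * p + l < r * p"
      using * by (auto intro: block_index_less)
    then show "\<xi> (i * p + k) * block_mat r p x $$ (i * p + k, j * p + l) * \<eta> (j * p + l)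
        = \<xi> (i * p + k) * x i j $$ (k, l) * \<eta> (j * p + l)"
      using * by (simp add: block_mat_def)
  qed
  also have "\<dots> = (\<Sum>i<r. \<Sum>j<r. \<Sum>k<p. \<Sum>l<p. \<xi> (i * p + k) * x i j $$ (k, l) * \<eta> (j * p + l))"
    by (rule sum.cong[OF refl], rule sum.swap)
  finally show ?thesis .
qed

section \<open>Linear maps on subspaces of matrices\<close>

text \<open>The form in which linear combinations are written in \<^const>\<open>mat_span\<close>.\<close>

definition lincomb :: "nat \<Rightarrow> nat \<Rightarrow> (nat \<Rightarrow> complex) \<Rightarrow> (nat \<Rightarrow> complex mat) \<Rightarrow> complex mat" where
  "lincomb p n c d = mat p p (\<lambda>ij. \<Sum>k<n. c k * d k $$ ij)"

text \<open>This covers both the domain $\ell_\infty^m$ of the maps in the 1-summing norm and the domain $M_N$ of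
  the unitary operators, so that linearity over finite sums is proved once.\<close>

definition mat_subspace :: "nat \<Rightarrow> complex mat set \<Rightarrow> bool" where
  "mat_subspace p E \<longleftrightarrow> E \<subseteq> carrier_mat p p \<and> 0\<^sub>m p p \<in> E \<and>
     (\<forall>x\<in>E. \<forall>y\<in>E. x + y \<in> E) \<and> (\<forall>a. \<forall>x\<in>E. a \<cdot>\<^sub>m x \<in> E)"

lemma lincomb_carrier [simp]: "lincomb p n c d \<in> carrier_mat p p"
  by (simp add: lincomb_def)

lemma lincomb_dim [simp]: "dim_row (lincomb p n c d) = p" "dim_col (lincomb p n c d) = p"
  by (simp_all add: lincomb_def)

lemma lincomb_index:
  "i < p \<Longrightarrow> j < p \<Longrightarrow> lincomb p n c d $$ (i, j) = (\<Sum>k<n. c k * d k $$ (i, j))"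
  by (simp add: lincomb_def)

lemma mat_subspace_carrier: "mat_subspace p (carrier_mat p p)"
  by (auto simp: mat_subspace_def)

lemma mat_subspace_linf: "mat_subspace m (linf m)"
  by (auto simp: mat_subspace_def linf_def diagonal_mat_def)

lemma linear_lincomb:
  assumes u: "mat_linear_on E u" and E: "mat_subspace p E" and q: "u ` E \<subseteq> carrier_mat q q"
    and d: "\<And>k. k < n \<Longrightarrow> d k \<in> E"
  shows "lincomb p n c d \<in> E" and "u (lincomb p n c d) = lincomb q n c (\<lambda>k. u (d k))"
proof -
  have "lincomb p n c d \<in> E \<and> u (lincomb p n c d) = lincomb q n c (\<lambda>k. u (d k))"
    using d
  proof (induction n)
    case 0
    have z: "lincomb p 0 c d = 0\<^sub>m p p" by (rule eq_matI) (auto simp: lincomb_def)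
    have z0: "0\<^sub>m p p \<in> E" using E by (simp add: mat_subspace_def)
    \<comment> \<open>The image of zero is zero by homogeneity, as the empty sum requires.\<close>
    have "u (0 \<cdot>\<^sub>m 0\<^sub>m p p) = 0 \<cdot>\<^sub>m u (0\<^sub>m p p)"
      using u z0 unfolding mat_linear_on_def by blast
    also have "(0::complex) \<cdot>\<^sub>m 0\<^sub>m p p = 0\<^sub>m p p" by (rule eq_matI) auto
    also have "0 \<cdot>\<^sub>m u (0\<^sub>m p p) = lincomb q 0 c (\<lambda>k. u (d k))"
      using q z0 by (intro eq_matI) (auto simp: lincomb_def)
    finally show ?case using z z0 by simp
  next
    case (Suc n)
    let ?x = "lincomb p n c d"
    have IH: "?x \<in> E" "u ?x = lincomb q n c (\<lambda>k. u (d k))" and dn: "d n \<in> E"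
      using Suc by auto
    have cdn: "c n \<cdot>\<^sub>m d n \<in> E" using dn E by (auto simp: mat_subspace_def)
    have dc: "d n \<in> carrier_mat p p" "u (d n) \<in> carrier_mat q q"
      using dn E q by (auto simp: mat_subspace_def)
    have eq: "lincomb p (Suc n) c d = ?x + c n \<cdot>\<^sub>m d n"
      using dc by (intro eq_matI) (auto simp: lincomb_def)
    have "u (?x + c n \<cdot>\<^sub>m d n) = u ?x + c n \<cdot>\<^sub>m u (d n)"
      using u IH(1) dn cdn unfolding mat_linear_on_def by metis
    also have "\<dots> = lincomb q (Suc n) c (\<lambda>k. u (d k))"
      using dc IH(2) by (intro eq_matI) (auto simp: lincomb_def)
    finally show ?case
      using eq IH(1) cdn E by (auto simp: mat_subspace_def)
  qed
  then show "lincomb p n c d \<in> E" "u (lincomb p n c d) = lincomb q n c (\<lambda>k. u (d k))" by auto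
qed

lemma mat_span_lincomb: "mat_span N n x = {lincomb N n c x | c. True}"
  by (simp add: mat_span_def lincomb_def)

lemma lincomb_in_span: "lincomb N n c x \<in> mat_span N n x"
  by (auto simp: mat_span_lincomb)

lemma mat_span_carrier: "mat_span N n x \<subseteq> carrier_mat N N"
  by (auto simp: mat_span_lincomb)

section \<open>Maps on $\ell_\infty^m$\<close>

lemma mat_unit_carrier [simp]: "mat_unit m i j \<in> carrier_mat m m"
  by (simp add: mat_unit_def)

lemma mat_unit_linf: "mat_unit m k k \<in> linf m"
  by (auto simp: linf_def mat_unit_def diagonal_mat_def)

lemma linf_eq_lincomb:
  assumes "d \<in> linf m"
  shows "d = lincomb m m (\<lambda>k. d $$ (k, k)) (\<lambda>k. mat_unit m k k)"
proof (rule eq_matI)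
  fix i j assume "i < dim_row (lincomb m m (\<lambda>k. d $$ (k, k)) (\<lambda>k. mat_unit m k k))"
    "j < dim_col (lincomb m m (\<lambda>k. d $$ (k, k)) (\<lambda>k. mat_unit m k k))"
  then have ij: "i < m" "j < m" by auto
  have "lincomb m m (\<lambda>k. d $$ (k, k)) (\<lambda>k. mat_unit m k k) $$ (i, j)
      = (\<Sum>k<m. if k = i then if i = j then d $$ (k, k) else 0 else 0)"
    using ij unfolding lincomb_index[OF ij] by (intro sum.cong) (auto simp: mat_unit_def)
  also have "\<dots> = d $$ (i, j)"
    using ij assms by (auto simp: linf_def diagonal_mat_def)
  finally show "d $$ (i, j) = lincomb m m (\<lambda>k. d $$ (k, k)) (\<lambda>k. mat_unit m k k) $$ (i, j)" by simp
qed (use assms in \<open>auto simp: linf_def\<close>)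

lemma linear_on_linf:
  assumes "mat_linear_on (linf m) u" "u ` linf m \<subseteq> carrier_mat N N" "d \<in> linf m"
  shows "u d = lincomb N m (\<lambda>k. d $$ (k, k)) (\<lambda>k. u (mat_unit m k k))"
  by (rule trans[OF arg_cong[OF linf_eq_lincomb[OF assms(3)], of u]
        linear_lincomb(2)[OF assms(1) mat_subspace_linf assms(2) mat_unit_linf]])

text \<open>Evaluation at a coordinate of $\ell_\infty^m$ is completely contractive: test vectors that are
  supported on the indices congruent to $l$ modulo $m$ see only the $l$-th diagonal entries of the
  blocks.\<close>

lemma linf_block_slice:
  assumes "opnorm (block_mat r m x) \<le> 1" "l < m"
  shows "cmod (\<Sum>i<r. \<Sum>j<r. \<alpha> i * x i j $$ (l, l) * \<beta> j) \<le> l2 r \<alpha> * l2 r \<beta>"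
proof -
  define lift where "lift \<gamma> = (\<lambda>a. if a mod m = l then \<gamma> (a div m) else (0::complex))"
    for \<gamma> :: "nat \<Rightarrow> complex"
  have lift: "lift \<gamma> (i * m + k) = (if k = l then \<gamma> i else 0)" if "k < m" for \<gamma> i k
    using that by (simp add: lift_def)
  have n: "l2 (r * m) (lift \<gamma>) = l2 r \<gamma>" for \<gamma>
  proof -
    have "(l2 (r * m) (lift \<gamma>))\<^sup>2 = (\<Sum>k<m. if k = l then \<Sum>i<r. (cmod (\<gamma> i))\<^sup>2 else 0)"
      unfolding l2_sq_blocks by (intro sum.cong) (auto simp: lift)
    also have "\<dots> = (l2 r \<gamma>)\<^sup>2" using assms(2) by (simp add: l2_sq)
    finally show ?thesis by (rule power2_eq_imp_eq) auto
  qed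
  have "bil (block_mat r m x) (lift \<alpha>) (lift \<beta>)
      = (\<Sum>i<r. \<Sum>j<r. \<Sum>k<m. if k = l then \<Sum>k'<m. if k' = l then \<alpha> i * x i j $$ (k, k') * \<beta> j else 0 else 0)"
    unfolding bil_block_mat
    by (intro sum.cong refl) (auto simp: lift if_distrib[of "(*) _"] cong: if_cong)
  also have "\<dots> = (\<Sum>i<r. \<Sum>j<r. \<alpha> i * x i j $$ (l, l) * \<beta> j)"
    using assms(2) by simp
  finally have "cmod (\<Sum>i<r. \<Sum>j<r. \<alpha> i * x i j $$ (l, l) * \<beta> j)
      \<le> opnorm (block_mat r m x) * l2 (r * m) (lift \<alpha>) * l2 (r * m) (lift \<beta>)"
    using bil_le_opnorm[of "block_mat r m x" "lift \<alpha>" "lift \<beta>"] by simp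
  also have "\<dots> \<le> 1 * l2 r \<alpha> * l2 r \<beta>"
    unfolding n using assms(1) by (intro mult_right_mono) auto
  finally show ?thesis by simp
qed

lemma cb_norm_le_1D:
  assumes "cb_norm p E q u \<le> 1" "\<And>i j. i < r \<Longrightarrow> j < r \<Longrightarrow> x i j \<in> E" "opnorm (block_mat r p x) \<le> 1"
  shows "opnorm (block_mat r q (\<lambda>i j. u (x i j))) \<le> 1"
proof -
  have "ennreal (opnorm (block_mat r q (\<lambda>i j. u (x i j)))) \<le> cb_norm p E q u"
    unfolding cb_norm_def using assms(2,3) by (intro Sup_upper) blast
  then show ?thesis using assms(1) by (metis ennreal_le_1 order_trans)
qed

section \<open>The 1-summing norm and the Hilbert--Schmidt norm\<close>

text \<open>The Hilbert--Schmidt norm, which is the norm of the Hilbert space $M_N$.\<close>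

definition hs :: "complex mat \<Rightarrow> real" where
  "hs x = sqrt (\<Sum>i<dim_row x. \<Sum>j<dim_col x. (cmod (x $$ (i, j)))\<^sup>2)"

lemma hs_nonneg [simp]: "0 \<le> hs x"
  by (simp add: hs_def sum_nonneg)

lemma hs_sq: "x \<in> carrier_mat p q \<Longrightarrow> (hs x)\<^sup>2 = (\<Sum>i<p. \<Sum>j<q. (cmod (x $$ (i, j)))\<^sup>2)"
  by (auto simp: hs_def sum_nonneg)

text \<open>The trace duality step. Amplify $u$ by $M_N$ and apply it to the contraction with $l$-th slice
  $\bar a_l / \|a_l\|$, where $a_l = u(e_l)$. The image $\sum_l \bar a_l \otimes a_l / \|a_l\|$ is again a
  contraction, and its quadratic form at the vector $\sum_i e_i \otimes e_i$ of squared norm $N$ is the left hand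
  side. If $\|a_l\| = 0$, the summand and the slice are $0$, as division by zero yields zero.\<close>

lemma sum_hs_sq_div_opnorm_le:
  assumes u: "mat_linear_on (linf m) u" "u ` linf m \<subseteq> carrier_mat N N" and cb: "cb_norm m (linf m) N u \<le> 1"
  shows "(\<Sum>l<m. (hs (u (mat_unit m l l)))\<^sup>2 / opnorm (u (mat_unit m l l))) \<le> real N"
proof -
  define a where "a l = u (mat_unit m l l)" for l
  have a: "a l \<in> carrier_mat N N" for l
    using u(2) mat_unit_linf by (auto simp: a_def)
  define x where "x i k = mat m m (\<lambda>(l, l'). if l = l' then cnj (a l $$ (i, k)) / of_real (opnorm (a l)) else 0)"
    for i k
  have x: "x i k \<in> linf m" for i k
    by (auto simp: x_def linf_def diagonal_mat_def)
  have "opnorm (block_mat N m x) \<le> 1"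
  proof (rule opnorm_le)
    fix \<xi> \<eta> :: "nat \<Rightarrow> complex"
    have "bil (block_mat N m x) \<xi> \<eta>
        = (\<Sum>i<N. \<Sum>j<N. \<Sum>l<m. \<xi> (i * m + l) * (cnj (a l $$ (i, j)) / of_real (opnorm (a l))) * \<eta> (j * m + l))"
      unfolding bil_block_mat
    proof (intro sum.cong refl)
      fix i j k assume k: "k \<in> {..<m}"
      have "(\<Sum>l<m. \<xi> (i * m + k) * x i j $$ (k, l) * \<eta> (j * m + l))
          = (\<Sum>l<m. if l = k then \<xi> (i * m + k) * (cnj (a k $$ (i, j)) / of_real (opnorm (a k))) * \<eta> (j * m + k) else 0)"
        using k by (intro sum.cong) (auto simp: x_def)
      then show "(\<Sum>l<m. \<xi> (i * m + k) * x i j $$ (k, l) * \<eta> (j * m + l))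
          = \<xi> (i * m + k) * (cnj (a k $$ (i, j)) / of_real (opnorm (a k))) * \<eta> (j * m + k)"
        using k by simp
    qed
    also have "\<dots> = (\<Sum>i<N. \<Sum>l<m. \<Sum>j<N. \<xi> (i * m + l) * (cnj (a l $$ (i, j)) / of_real (opnorm (a l))) * \<eta> (j * m + l))"
      by (rule sum.cong[OF refl], rule sum.swap)
    also have "\<dots> = (\<Sum>l<m. \<Sum>i<N. \<Sum>j<N. \<xi> (i * m + l) * (cnj (a l $$ (i, j)) / of_real (opnorm (a l))) * \<eta> (j * m + l))"
      by (rule sum.swap)
    also have "\<dots> = (\<Sum>l<m. (\<Sum>i<N. \<Sum>j<N. \<xi> (i * m + l) * cnj (a l $$ (i, j)) * \<eta> (j * m + l)) / of_real (opnorm (a l)))"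
      by (simp add: sum_divide_distrib)
    finally have "cmod (bil (block_mat N m x) \<xi> \<eta>) = cmod (\<Sum>l<m. (\<Sum>i<N. \<Sum>j<N. \<xi> (i * m + l) * cnj (a l $$ (i, j)) * \<eta> (j * m + l)) / of_real (opnorm (a l)))"
      by simp
    also have "\<dots> \<le> (\<Sum>l<m. l2 N (\<lambda>i. \<xi> (i * m + l)) * l2 N (\<lambda>j. \<eta> (j * m + l)))"
    proof (rule sum_norm_le)
      fix l assume "l \<in> {..<m}"
      have "cmod (\<Sum>i<N. \<Sum>j<N. \<xi> (i * m + l) * cnj (a l $$ (i, j)) * \<eta> (j * m + l))
          \<le> opnorm (a l) * (l2 N (\<lambda>i. \<xi> (i * m + l)) * l2 N (\<lambda>j. \<eta> (j * m + l)))"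
        using opnorm_cnj_bil_le[of "\<lambda>i. \<xi> (i * m + l)" "a l" "\<lambda>j. \<eta> (j * m + l)"] a[of l]
        by (simp add: mult.assoc)
      then show "cmod ((\<Sum>i<N. \<Sum>j<N. \<xi> (i * m + l) * cnj (a l $$ (i, j)) * \<eta> (j * m + l)) / of_real (opnorm (a l)))
          \<le> l2 N (\<lambda>i. \<xi> (i * m + l)) * l2 N (\<lambda>j. \<eta> (j * m + l))"
        using opnorm_nonneg[of "a l"]
        by (cases "opnorm (a l) = 0") (auto simp: norm_divide divide_le_eq mult_ac)
    qed
    also have "\<dots> \<le> l2 (N * m) \<xi> * l2 (N * m) \<eta>"
      using sum_l2_mult_le[of "{..<m}" N "\<lambda>l i. \<xi> (i * m + l)" N "\<lambda>l j. \<eta> (j * m + l)"]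
      unfolding l2_sq_blocks[symmetric] by simp
    finally show "cmod (bil (block_mat N m x) \<xi> \<eta>)
        \<le> 1 * l2 (dim_row (block_mat N m x)) \<xi> * l2 (dim_col (block_mat N m x)) \<eta>" by simp
  qed simp
  then have ux: "opnorm (block_mat N N (\<lambda>i j. u (x i j))) \<le> 1"
    by (intro cb_norm_le_1D[OF cb] x) auto
  \<comment> \<open>The vector $\sum_i e_i \otimes e_i$, in the index convention of the block matrices.\<close>
  define \<omega> :: "nat \<Rightarrow> complex" where "\<omega> a = (if a mod N = a div N then 1 else 0)" for a
  have \<omega>: "\<omega> (i * N + k) = (if k = i then 1 else 0)" if "k < N" for i k
    using that by (simp add: \<omega>_def)
  have "(l2 (N * N) \<omega>)\<^sup>2 = (\<Sum>i<N. \<Sum>k<N. if k = i then 1 else 0)"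
    unfolding l2_sq sum_lessThan_mult by (intro sum.cong refl) (simp add: \<omega>)
  then have \<omega>n: "l2 (N * N) \<omega> * l2 (N * N) \<omega> = real N"
    by (simp add: power2_eq_square)
  have "bil (block_mat N N (\<lambda>i j. u (x i j))) \<omega> \<omega>
      = (\<Sum>i<N. \<Sum>j<N. \<Sum>k<N. if k = i then \<Sum>l<N. if l = j then u (x i j) $$ (k, l) else 0 else 0)"
    unfolding bil_block_mat
    by (intro sum.cong refl) (auto simp: \<omega> if_distrib[of "(*) _"] cong: if_cong)
  also have "\<dots> = (\<Sum>i<N. \<Sum>j<N. u (x i j) $$ (i, j))"
    by simp
  also have "\<dots> = (\<Sum>i<N. \<Sum>j<N. \<Sum>l<m. of_real ((cmod (a l $$ (i, j)))\<^sup>2 / opnorm (a l)))"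
  proof (intro sum.cong refl)
    fix i j assume ij: "i \<in> {..<N}" "j \<in> {..<N}"
    have "u (x i j) $$ (i, j) = (\<Sum>l<m. x i j $$ (l, l) * a l $$ (i, j))"
      unfolding linear_on_linf[OF u x] a_def using ij by (simp add: lincomb_index)
    also have "\<dots> = (\<Sum>l<m. of_real ((cmod (a l $$ (i, j)))\<^sup>2 / opnorm (a l)))"
      by (intro sum.cong) (auto simp: x_def complex_norm_square mult.commute simp del: of_real_power)
    finally show "u (x i j) $$ (i, j) = \<dots>" .
  qed
  also have "\<dots> = (\<Sum>i<N. \<Sum>l<m. \<Sum>j<N. of_real ((cmod (a l $$ (i, j)))\<^sup>2 / opnorm (a l)))"
    by (rule sum.cong[OF refl], rule sum.swap)
  also have "\<dots> = (\<Sum>l<m. \<Sum>i<N. \<Sum>j<N. of_real ((cmod (a l $$ (i, j)))\<^sup>2 / opnorm (a l)))"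
    by (rule sum.swap)
  also have "\<dots> = complex_of_real (\<Sum>l<m. (hs (a l))\<^sup>2 / opnorm (a l))"
    by (simp add: hs_sq[OF a] sum_divide_distrib)
  finally have "(\<Sum>l<m. (hs (a l))\<^sup>2 / opnorm (a l)) \<le> cmod (bil (block_mat N N (\<lambda>i j. u (x i j))) \<omega> \<omega>)"
    by (simp del: of_real_sum)
  also have "\<dots> \<le> opnorm (block_mat N N (\<lambda>i j. u (x i j))) * (l2 (N * N) \<omega> * l2 (N * N) \<omega>)"
    using bil_le_opnorm[of "block_mat N N (\<lambda>i j. u (x i j))" \<omega> \<omega>] by (simp add: mult.assoc)
  also have "\<dots> \<le> 1 * real N"
    unfolding \<omega>n using ux by (intro mult_right_mono) auto
  finally show ?thesis by (simp add: a_def)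
qed

text \<open>For $x \ne 0$ in $E$ the hypothesis reads $C \|x\|_2^2 / \|x\| \ge N \|x\|$, so up to the factor $C/N$
  the summands of the previous lemma dominate those of the 1-summing norm.\<close>

lemma pi_1cb_le_of_opnorm_le_hs:
  assumes E: "E \<subseteq> carrier_mat N N"
    and K: "\<And>x. x \<in> E \<Longrightarrow> real N * (opnorm x)\<^sup>2 \<le> C * (hs x)\<^sup>2" and C: "0 \<le> C"
  shows "pi_1cb N E opnorm id \<le> ennreal C"
  unfolding pi_1cb_def
proof (rule Sup_least, clarify)
  fix m u assume u: "mat_linear_on (linf m) u" "u ` linf m \<subseteq> E" "cb_norm m (linf m) N u \<le> 1"
  define a where "a l = u (mat_unit m l l)" for l
  have "real N * (\<Sum>l<m. opnorm (a l)) \<le> C * (\<Sum>l<m. (hs (a l))\<^sup>2 / opnorm (a l))"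
    unfolding sum_distrib_left
  proof (rule sum_mono)
    fix l assume "l \<in> {..<m}"
    have "a l \<in> E" using u(2) mat_unit_linf by (auto simp: a_def)
    from K[OF this] show "real N * opnorm (a l) \<le> C * ((hs (a l))\<^sup>2 / opnorm (a l))"
      using opnorm_nonneg[of "a l"]
      by (cases "opnorm (a l) = 0") (auto simp: le_divide_eq power2_eq_square mult_ac)
  qed
  also have "\<dots> \<le> C * real N"
    using sum_hs_sq_div_opnorm_le[OF u(1) _ u(3)] u(2) E C
    unfolding a_def by (intro mult_left_mono) auto
  finally have le: "real N * (\<Sum>l<m. opnorm (a l)) \<le> C * real N" .
  have "(\<Sum>l<m. opnorm (a l)) \<le> C"
  proof (cases "N = 0")
    case True
    have "a l \<in> carrier_mat 0 0" for l
      using u(2) mat_unit_linf E True by (force simp: a_def)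
    then have "opnorm (a l) = 0" for l
      using opnorm_le_sum_entries[of "a l" 0 0] opnorm_nonneg[of "a l"] by simp
    then show ?thesis using C by simp
  next
    case False
    then show ?thesis using le by simp
  qed
  then show "ennreal (\<Sum>k<m. opnorm (id (u (mat_unit m k k)))) \<le> ennreal C"
    by (auto simp: a_def intro!: ennreal_leI)
qed

section \<open>Sums with random signs\<close>

text \<open>Hoeffding's lemma for a fair coin with values $0$ and $2a$, centred.\<close>

lemma exp_plus_exp_minus_le: "exp a + exp (- a) \<le> 2 * exp (a\<^sup>2 / 2)" for a :: real
proof -
  have *: "exp a + exp (- a) \<le> 2 * exp (a\<^sup>2 / 2)" if "a \<ge> 0" for a :: real
  proof -
    have "ln ((1 + exp (2 * a)) / 2) \<le> a + a\<^sup>2 / 2"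
      using Hoeffdings_lemma_aux[of "2 * a" "1 / 2"] that by (simp add: field_simps)
    then have "exp (ln ((1 + exp (2 * a)) / 2)) \<le> exp (a + a\<^sup>2 / 2)"
      by simp
    also have "exp (ln ((1 + exp (2 * a)) / 2)) = (1 + exp (2 * a)) / 2"
      by (rule exp_ln) (simp add: add_pos_pos)
    finally have "exp (- a) * (1 + exp (2 * a)) \<le> exp (- a) * (2 * exp (a + a\<^sup>2 / 2))"
      by (intro mult_left_mono) auto
    then show ?thesis
      by (simp add: distrib_left exp_add[symmetric] add.commute mult.left_commute)
  qed
  show ?thesis using *[of a] *[of "- a"] by (cases "a \<ge> 0") auto
qed

abbreviation signs :: "'i set \<Rightarrow> ('i \<Rightarrow> real) set" where
  "signs I \<equiv> I \<rightarrow>\<^sub>E {-1, 1}"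

lemma card_signs: "finite I \<Longrightarrow> card (signs I) = 2 ^ card I"
  by (simp add: card_PiE numeral_2_eq_2)

text \<open>Chernoff's bound with parameter $s$: the exponential moment of a sign sum factorizes over the
  coordinates.\<close>

lemma card_signs_sum_ge:
  assumes I: "finite I" and a: "(\<Sum>i\<in>I. (a i)\<^sup>2) \<le> 1" and s: "0 \<le> s"
  shows "real (card {\<epsilon> \<in> signs I. s \<le> (\<Sum>i\<in>I. \<epsilon> i * a i)}) \<le> 2 ^ card I * exp (- s\<^sup>2 / 2)"
proof -
  let ?S = "{\<epsilon> \<in> signs I. s \<le> (\<Sum>i\<in>I. \<epsilon> i * a i)}"
  have fin: "finite (signs I)" using I by (intro finite_PiE) auto
  have "real (card ?S) * exp (s\<^sup>2) = (\<Sum>\<epsilon>\<in>?S. exp (s\<^sup>2))" by simp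
  also have "\<dots> \<le> (\<Sum>\<epsilon>\<in>?S. exp (s * (\<Sum>i\<in>I. \<epsilon> i * a i)))"
    using s by (intro sum_mono) (auto simp: power2_eq_square intro!: mult_left_mono)
  also have "\<dots> \<le> (\<Sum>\<epsilon>\<in>signs I. exp (s * (\<Sum>i\<in>I. \<epsilon> i * a i)))"
    using fin by (intro sum_mono2) auto
  also have "\<dots> = (\<Sum>\<epsilon>\<in>signs I. \<Prod>i\<in>I. exp (s * (\<epsilon> i * a i)))"
    using I by (simp add: sum_distrib_left exp_sum)
  also have "\<dots> = (\<Prod>i\<in>I. \<Sum>e\<in>{-1, 1}. exp (s * (e * a i)))"
    using I by (subst prod_sum_PiE) auto
  also have "\<dots> \<le> (\<Prod>i\<in>I. 2 * exp ((s * a i)\<^sup>2 / 2))"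
    using exp_plus_exp_minus_le[of "s * a _"]
    by (intro prod_mono) (auto simp: add.commute add_nonneg_nonneg)
  also have "\<dots> = 2 ^ card I * exp (s\<^sup>2 / 2 * (\<Sum>i\<in>I. (a i)\<^sup>2))"
    using I by (simp add: prod.distrib exp_sum[symmetric] sum_distrib_left power_mult_distrib)
  also have "\<dots> \<le> 2 ^ card I * exp (s\<^sup>2 / 2 * 1)"
    using a by (intro mult_left_mono iffD2[OF exp_le_cancel_iff]) auto
  finally have "real (card ?S) * exp (s\<^sup>2) * exp (- s\<^sup>2) \<le> 2 ^ card I * exp (s\<^sup>2 / 2) * exp (- s\<^sup>2)"
    by (intro mult_right_mono) auto
  then show ?thesis by (simp add: mult.assoc exp_add[symmetric])
qed

text \<open>If a complex number has modulus at least $s$, then one of $\pm\mathrm{Re}$, $\pm\mathrm{Im}$ is at least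
  $s/2$; this is where the factor $4$ and the weaker exponent come from.\<close>

lemma card_signs_cmod_ge:
  assumes I: "finite I" and x: "(\<Sum>i\<in>I. (cmod (x i))\<^sup>2) \<le> 1" and s: "0 \<le> s"
  shows "real (card {\<epsilon> \<in> signs I. s \<le> cmod (\<Sum>i\<in>I. of_real (\<epsilon> i) * x i)})
    \<le> 2 ^ card I * (4 * exp (- s\<^sup>2 / 8))"
proof -
  define S where "S a = {\<epsilon> \<in> signs I. s / 2 \<le> (\<Sum>i\<in>I. \<epsilon> i * a i)}" for a
  have fin: "finite (signs I)" using I by (intro finite_PiE) auto
  have S: "real (card (S a)) \<le> 2 ^ card I * exp (- s\<^sup>2 / 8)" if "\<And>i. \<bar>a i\<bar> \<le> cmod (x i)" for a
  proof -
    have "(\<Sum>i\<in>I. (a i)\<^sup>2) \<le> (\<Sum>i\<in>I. (cmod (x i))\<^sup>2)"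
      using that by (intro sum_mono) (simp add: abs_le_square_iff[symmetric])
    then have "(\<Sum>i\<in>I. (a i)\<^sup>2) \<le> 1" using x by simp
    from card_signs_sum_ge[OF I this, of "s / 2"] show ?thesis
      using s by (simp add: S_def power_divide)
  qed
  have "{\<epsilon> \<in> signs I. s \<le> cmod (\<Sum>i\<in>I. of_real (\<epsilon> i) * x i)}
      \<subseteq> (S (\<lambda>i. Re (x i)) \<union> S (\<lambda>i. - Re (x i))) \<union> (S (\<lambda>i. Im (x i)) \<union> S (\<lambda>i. - Im (x i)))"
  proof (clarify)
    fix \<epsilon> assume \<epsilon>: "\<epsilon> \<in> signs I" "s \<le> cmod (\<Sum>i\<in>I. of_real (\<epsilon> i) * x i)"
      "\<epsilon> \<notin> S (\<lambda>i. Im (x i))" "\<epsilon> \<notin> S (\<lambda>i. - Im (x i))" "\<epsilon> \<notin> S (\<lambda>i. - Re (x i))"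
    have "s \<le> \<bar>\<Sum>i\<in>I. \<epsilon> i * Re (x i)\<bar> + \<bar>\<Sum>i\<in>I. \<epsilon> i * Im (x i)\<bar>"
      using \<epsilon>(2) cmod_le[of "\<Sum>i\<in>I. of_real (\<epsilon> i) * x i"] by simp
    then show "\<epsilon> \<in> S (\<lambda>i. Re (x i))"
      using \<epsilon> by (auto simp: S_def sum_negf)
  qed
  then have "card {\<epsilon> \<in> signs I. s \<le> cmod (\<Sum>i\<in>I. of_real (\<epsilon> i) * x i)}
      \<le> card ((S (\<lambda>i. Re (x i)) \<union> S (\<lambda>i. - Re (x i))) \<union> (S (\<lambda>i. Im (x i)) \<union> S (\<lambda>i. - Im (x i))))"
    using fin by (intro card_mono) (auto simp: S_def)
  also have "\<dots> \<le> (card (S (\<lambda>i. Re (x i))) + card (S (\<lambda>i. - Re (x i))))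
      + (card (S (\<lambda>i. Im (x i))) + card (S (\<lambda>i. - Im (x i))))"
    by (rule order_trans[OF card_Un_le add_mono[OF card_Un_le card_Un_le]])
  finally show ?thesis
    using S[of "\<lambda>i. Re (x i)"] S[of "\<lambda>i. - Re (x i)"] S[of "\<lambda>i. Im (x i)"] S[of "\<lambda>i. - Im (x i)"]
    by (simp add: abs_Re_le_cmod abs_Im_le_cmod)
qed

section \<open>Nets of the complex unit ball\<close>

lemma sum_half_power_abs_le: "(\<Sum>a\<in>{- int B..int B}. (1 / 2 :: real) ^ nat \<bar>a\<bar>) \<le> 3 - 2 * (1 / 2) ^ B"
proof (induction B)
  case (Suc B)
  have "{- int (Suc B)..int (Suc B)} = insert (- int (Suc B)) (insert (int (Suc B)) {- int B..int B})"
    by auto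
  then have "(\<Sum>a\<in>{- int (Suc B)..int (Suc B)}. (1 / 2 :: real) ^ nat \<bar>a\<bar>)
      = 2 * (1 / 2) ^ Suc B + (\<Sum>a\<in>{- int B..int B}. (1 / 2 :: real) ^ nat \<bar>a\<bar>)"
    by (simp add: nat_add_distrib)
  then show ?case using Suc by simp
qed simp

lemma abs_le_square_int: "\<bar>a\<bar> \<le> a\<^sup>2" for a :: int
  using mult_left_mono[of 1 "\<bar>a\<bar>" "\<bar>a\<bar>"] by (cases "a = 0") (auto simp: power2_eq_square)

text \<open>The number of lattice points in a ball, by weighting a point with $2^{-\sum_i (|a_i| + |b_i|)}$. On
  the ball the weight is at least $2^{-L}$, as $|a| \le a^2$ for integers, while the sum of all weights
  factorizes over the coordinates into factors $\bigl(\sum_a 2^{-|a|}\bigr)^2 \le 9$.\<close>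

lemma card_lattice_ball_le:
  assumes S: "S = {- int B..int B} \<times> {- int B..int B}"
  shows "real (card {g \<in> {..<D} \<rightarrow>\<^sub>E S. (\<Sum>i<D. (fst (g i))\<^sup>2 + (snd (g i))\<^sup>2) \<le> int L}) \<le> 2 ^ L * 9 ^ D"
    (is "real (card ?G) \<le> _")
proof -
  define w :: "int \<times> int \<Rightarrow> nat" where "w p = nat \<bar>fst p\<bar> + nat \<bar>snd p\<bar>" for p
  have finS: "finite S" by (simp add: S)
  have fin: "finite ({..<D} \<rightarrow>\<^sub>E S)" using finS by (intro finite_PiE) auto
  have wS: "(\<Sum>p\<in>S. (1 / 2 :: real) ^ w p) \<le> 9"
  proof -
    have "(\<Sum>p\<in>S. (1 / 2 :: real) ^ w p) = (\<Sum>a\<in>{- int B..int B}. (1 / 2 :: real) ^ nat \<bar>a\<bar>) ^ 2"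
      by (simp add: S w_def power_add sum.cartesian_product sum_product power2_eq_square case_prod_unfold)
    also have "\<dots> \<le> 3 ^ 2"
      using sum_half_power_abs_le[of B] by (intro power_mono) (auto intro: sum_nonneg order_trans)
    finally show ?thesis by simp
  qed
  have "real (card ?G) * (1 / 2) ^ L = (\<Sum>g\<in>?G. (1 / 2) ^ L)" by simp
  also have "\<dots> \<le> (\<Sum>g\<in>?G. (1 / 2) ^ (\<Sum>i<D. w (g i)))"
  proof (rule sum_mono)
    fix g assume "g \<in> ?G"
    have "int (\<Sum>i<D. w (g i)) = (\<Sum>i<D. \<bar>fst (g i)\<bar> + \<bar>snd (g i)\<bar>)"
      by (simp add: w_def)
    also have "\<dots> \<le> (\<Sum>i<D. (fst (g i))\<^sup>2 + (snd (g i))\<^sup>2)"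
      by (intro sum_mono add_mono abs_le_square_int)
    also have "\<dots> \<le> int L" using \<open>g \<in> ?G\<close> by simp
    finally have "(\<Sum>i<D. w (g i)) \<le> L" by (simp only: of_nat_le_iff)
    then show "(1 / 2 :: real) ^ L \<le> (1 / 2) ^ (\<Sum>i<D. w (g i))"
      by (intro power_decreasing) auto
  qed
  also have "\<dots> \<le> (\<Sum>g\<in>{..<D} \<rightarrow>\<^sub>E S. (1 / 2) ^ (\<Sum>i<D. w (g i)))"
    using fin by (intro sum_mono2) auto
  also have "\<dots> = (\<Sum>g\<in>{..<D} \<rightarrow>\<^sub>E S. \<Prod>i<D. (1 / 2) ^ w (g i))"
    by (simp add: power_sum)
  also have "\<dots> = (\<Prod>i<D. \<Sum>p\<in>S. (1 / 2) ^ w p)"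
    using finS by (subst prod_sum_PiE) auto
  also have "\<dots> \<le> 9 ^ D"
    using power_mono[OF wS, of D] by (simp add: sum_nonneg)
  finally show ?thesis by (simp add: power_divide field_simps)
qed

text \<open>Rounding toward $0$ never increases the absolute value, so the approximating lattice points stay
  in the unit ball.\<close>

definition trunc :: "real \<Rightarrow> int" where
  "trunc t = (if 0 \<le> t then \<lfloor>t\<rfloor> else \<lceil>t\<rceil>)"

lemma abs_trunc_le: "\<bar>real_of_int (trunc t)\<bar> \<le> \<bar>t\<bar>"
  using floor_correct[of t] ceiling_correct[of t] zero_le_floor[of t] ceiling_le_zero[of t]
  by (auto simp: trunc_def)

lemma abs_minus_trunc_le: "\<bar>t - real_of_int (trunc t)\<bar> \<le> 1"
proof (cases "0 \<le> t")
  case True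
  then show ?thesis
    using of_int_floor_le[of t] real_of_int_floor_add_one_gt[of t] unfolding trunc_def by (simp only: if_True; linarith)
next
  case False
  then show ?thesis
    using le_of_int_ceiling[of t] of_int_ceiling_diff_one_le[of t] unfolding trunc_def by (simp only: if_False; linarith)
qed

text \<open>The net consists of the points of the lattice $h\,\mathbb Z[i]^D$ in the unit ball, with
  $h = 1 / (6 \sqrt N)$. Rounding moves each coordinate by at most $\sqrt 2\, h$, hence a vector by at
  most $\sqrt{2N}\, h = \sqrt 2 / 6 < 1/4$. In lattice units the ball has squared radius $36 N$, which
  gives the cardinality. The mesh is tied to $N$ rather than to the dimension $D \le N$, so that
  one constant serves all three slots of the trilinear form.\<close>

lemma exists_net:
  assumes N: "0 < N" and D: "D \<le> N"
  obtains F where "finite F" "real (card F) \<le> (9 * 2 ^ 36) ^ N" "\<And>f. f \<in> F \<Longrightarrow> l2 D f \<le> 1"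
    "\<And>f. l2 D f \<le> 1 \<Longrightarrow> \<exists>g\<in>F. l2 D (\<lambda>i. f i - g i) \<le> 1 / 4"
proof -
  define h where "h = 1 / (6 * sqrt (real N))"
  have h: "0 < h" and h2: "h\<^sup>2 = 1 / (36 * real N)"
    using N by (auto simp: h_def power_divide power_mult_distrib)
  define S where "S = {- int (36 * N)..int (36 * N)} \<times> {- int (36 * N)..int (36 * N)}"
  define G where "G = {g \<in> {..<D} \<rightarrow>\<^sub>E S. (\<Sum>i<D. (fst (g i))\<^sup>2 + (snd (g i))\<^sup>2) \<le> int (36 * N)}"
  define emb where "emb g i = of_real h * Complex (real_of_int (fst (g i))) (real_of_int (snd (g i)))"
    for g :: "nat \<Rightarrow> int \<times> int" and i
  have "finite ({..<D} \<rightarrow>\<^sub>E S)" unfolding S_def by (intro finite_PiE) auto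
  then have finG: "finite G" by (simp add: G_def)
  have "real (card G) \<le> 2 ^ (36 * N) * 9 ^ D"
    unfolding G_def by (rule card_lattice_ball_le[OF S_def])
  also have "\<dots> \<le> 2 ^ (36 * N) * 9 ^ N"
    using D by (intro mult_left_mono power_increasing) auto
  also have "\<dots> = (9 * 2 ^ 36) ^ N" by (simp only: power_mult_distrib power_mult[symmetric] mult.commute)
  finally have cG: "real (card G) \<le> (9 * 2 ^ 36) ^ N" .
  show ?thesis
  proof
    show "finite (emb ` G)" using finG by simp
    have "card (emb ` G) \<le> card G" by (rule card_image_le[OF finG])
    then show "real (card (emb ` G)) \<le> (9 * 2 ^ 36) ^ N" using cG by linarith
  next
    fix f assume "f \<in> emb ` G"
    then obtain g where g: "g \<in> G" "f = emb g" by auto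
    have "(\<Sum>i<D. (cmod (emb g i))\<^sup>2) = h\<^sup>2 * real_of_int (\<Sum>i<D. (fst (g i))\<^sup>2 + (snd (g i))\<^sup>2)"
      by (simp add: emb_def norm_mult power_mult_distrib cmod_power2 sum_distrib_left sum.distrib distrib_left)
    also have "\<dots> \<le> h\<^sup>2 * real_of_int (int (36 * N))"
      using g(1) unfolding G_def by (intro mult_left_mono of_int_le_iff[THEN iffD2]) auto
    also have "\<dots> = 1" using N by (simp add: h2)
    finally show "l2 D f \<le> 1" by (simp add: l2_le_1_iff g(2))
  next
    fix f assume f: "l2 D f \<le> 1"
    define g where "g = (\<lambda>i\<in>{..<D}. (trunc (Re (f i) / h), trunc (Im (f i) / h)))"
    have sq: "(real_of_int (trunc t))\<^sup>2 \<le> t\<^sup>2" for t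
      using abs_trunc_le[of t] by (simp add: abs_le_square_iff)
    have "real_of_int (\<Sum>i<D. (fst (g i))\<^sup>2 + (snd (g i))\<^sup>2) \<le> (\<Sum>i<D. (Re (f i) / h)\<^sup>2 + (Im (f i) / h)\<^sup>2)"
      using sq by (auto simp: g_def intro!: sum_mono add_mono)
    also have "\<dots> = (\<Sum>i<D. (cmod (f i))\<^sup>2) * (1 / h\<^sup>2)"
      by (simp add: cmod_power2 power_divide add_divide_distrib sum_divide_distrib sum.distrib)
    also have "\<dots> \<le> 1 * (1 / h\<^sup>2)"
      using f by (intro mult_right_mono) (auto simp: l2_le_1_iff)
    also have "\<dots> = real_of_int (int (36 * N))" by (simp add: h2)
    finally have s: "(\<Sum>i<D. (fst (g i))\<^sup>2 + (snd (g i))\<^sup>2) \<le> int (36 * N)"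
      by (simp only: of_int_le_iff)
    have gS: "g i \<in> S" if "i < D" for i
    proof -
      have "(fst (g i))\<^sup>2 + (snd (g i))\<^sup>2 \<le> (\<Sum>i<D. (fst (g i))\<^sup>2 + (snd (g i))\<^sup>2)"
        using that by (intro member_le_sum[of i "{..<D}" "\<lambda>i. (fst (g i))\<^sup>2 + (snd (g i))\<^sup>2"]) auto
      then have "(fst (g i))\<^sup>2 + (snd (g i))\<^sup>2 \<le> int (36 * N)" using s by linarith
      then have "\<bar>fst (g i)\<bar> \<le> int (36 * N)" "\<bar>snd (g i)\<bar> \<le> int (36 * N)"
        using abs_le_square_int[of "fst (g i)"] abs_le_square_int[of "snd (g i)"]
          zero_le_power2[of "fst (g i)"] zero_le_power2[of "snd (g i)"] by linarith+
      then show ?thesis by (auto simp: S_def mem_Times_iff)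
    qed
    have "g \<in> G" using s gS by (auto simp: G_def g_def)
    moreover have "l2 D (\<lambda>i. f i - emb g i) \<le> 1 / 4"
    proof -
      have "(l2 D (\<lambda>i. f i - emb g i))\<^sup>2 \<le> (\<Sum>i<D. h\<^sup>2 * 2)"
        unfolding l2_sq
      proof (rule sum_mono)
        fix i assume i: "i \<in> {..<D}"
        have e: "(t - h * real_of_int (trunc (t / h)))\<^sup>2 \<le> h\<^sup>2" for t
        proof -
          have "t - h * real_of_int (trunc (t / h)) = h * (t / h - real_of_int (trunc (t / h)))"
            using h by (simp add: right_diff_distrib)
          then have "\<bar>t - h * real_of_int (trunc (t / h))\<bar> \<le> h"
            using h mult_left_mono[OF abs_minus_trunc_le[of "t / h"], of h] by (simp add: abs_mult)
          then show ?thesis using abs_le_square_iff[of _ h] h by auto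
        qed
        show "(cmod (f i - emb g i))\<^sup>2 \<le> h\<^sup>2 * 2"
          using e[of "Re (f i)"] e[of "Im (f i)"] i by (simp add: cmod_power2 emb_def g_def)
      qed
      also have "\<dots> \<le> real N * (h\<^sup>2 * 2)"
        using D by (simp add: mult_right_mono)
      also have "\<dots> \<le> (1 / 4)\<^sup>2" using N by (simp add: h2 power_divide)
      finally show ?thesis by (rule power2_le_imp_le) simp
    qed
    ultimately show "\<exists>g\<in>emb ` G. l2 D (\<lambda>i. f i - g i) \<le> 1 / 4" by blast
  qed
qed

section \<open>Trilinear forms and nets\<close>

text \<open>If $\|f\| = 0$, then all multiples of $f$ lie in the unit ball, and the bound forces $\phi(f) = 0$.\<close>

lemma homogeneous_le:
  assumes hom: "\<And>a f. \<phi> (\<lambda>i. a * f i) = a * (\<phi> f :: complex)" and M: "\<And>f. l2 D f \<le> 1 \<Longrightarrow> cmod (\<phi> f) \<le> M"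
  shows "cmod (\<phi> f) \<le> M * l2 D f"
proof (cases "l2 D f = 0")
  case True
  have "\<phi> f = 0"
  proof (rule ccontr)
    assume nz: "\<phi> f \<noteq> 0"
    define a where "a = complex_of_real ((\<bar>M\<bar> + 1) / cmod (\<phi> f))"
    have "cmod (\<phi> (\<lambda>i. a * f i)) \<le> M" by (intro M) (simp add: l2_scale True)
    then have "cmod a * cmod (\<phi> f) \<le> M" by (simp only: hom norm_mult)
    then show False using nz by (simp add: a_def norm_divide abs_of_nonneg)
  qed
  then show ?thesis using True by simp
next
  case False
  define a where "a = complex_of_real (l2 D f)"
  have a: "a \<noteq> 0" using False by (simp add: a_def)
  have "cmod (\<phi> (\<lambda>i. (1 / a) * f i)) \<le> M"
    using False by (intro M) (simp only: l2_scale, simp add: a_def norm_divide)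
  then have "cmod (\<phi> f) / l2 D f \<le> M"
    by (simp only: hom) (simp add: a_def norm_mult norm_divide)
  then show ?thesis using False l2_nonneg[of D f] by (simp add: divide_le_eq del: l2_nonneg)
qed

text \<open>Let $s$ be the norm of the form. Replacing the three arguments one after the other by points of the
  nets costs at most $s/4$ each, so $s \le M + \frac34 s$. The a priori bound $B$ only makes $s$
  finite.\<close>

lemma trilinear_net_le:
  fixes T :: "(nat \<Rightarrow> complex) \<Rightarrow> (nat \<Rightarrow> complex) \<Rightarrow> (nat \<Rightarrow> complex) \<Rightarrow> complex"
  assumes diff: "\<And>a b y z. T (\<lambda>i. a i - b i) y z = T a y z - T b y z"
      "\<And>x a b z. T x (\<lambda>i. a i - b i) z = T x a z - T x b z"
      "\<And>x y a b. T x y (\<lambda>i. a i - b i) = T x y a - T x y b"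
    and hom: "\<And>s x y z. T (\<lambda>i. s * x i) y z = s * T x y z"
      "\<And>s x y z. T x (\<lambda>i. s * y i) z = s * T x y z"
      "\<And>s x y z. T x y (\<lambda>i. s * z i) = s * T x y z"
    and bdd: "\<And>x y z. l2 d x \<le> 1 \<Longrightarrow> l2 e y \<le> 1 \<Longrightarrow> l2 g z \<le> 1 \<Longrightarrow> cmod (T x y z) \<le> B"
    and X: "\<And>f. f \<in> X \<Longrightarrow> l2 d f \<le> 1" "\<And>f. l2 d f \<le> 1 \<Longrightarrow> \<exists>f'\<in>X. l2 d (\<lambda>i. f i - f' i) \<le> 1 / 4"
    and Y: "\<And>f. f \<in> Y \<Longrightarrow> l2 e f \<le> 1" "\<And>f. l2 e f \<le> 1 \<Longrightarrow> \<exists>f'\<in>Y. l2 e (\<lambda>i. f i - f' i) \<le> 1 / 4"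
    and Z: "\<And>f. f \<in> Z \<Longrightarrow> l2 g f \<le> 1" "\<And>f. l2 g f \<le> 1 \<Longrightarrow> \<exists>f'\<in>Z. l2 g (\<lambda>i. f i - f' i) \<le> 1 / 4"
    and M: "\<And>x y z. x \<in> X \<Longrightarrow> y \<in> Y \<Longrightarrow> z \<in> Z \<Longrightarrow> cmod (T x y z) \<le> M"
  shows "cmod (T x y z) \<le> 4 * M * l2 d x * l2 e y * l2 g z"
proof -
  define V where "V = {cmod (T x y z) | x y z. l2 d x \<le> 1 \<and> l2 e y \<le> 1 \<and> l2 g z \<le> 1}"
  define s where "s = Sup V"
  have z0: "l2 k (\<lambda>_. 0) = 0" for k by (simp add: l2_def L2_set_def)
  have bddV: "bdd_above V" using bdd by (auto simp: V_def intro!: bdd_aboveI[of _ B])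
  have neV: "V \<noteq> {}" using z0 by (auto simp: V_def intro!: exI[of _ "\<lambda>_. 0"])
  have s: "cmod (T x y z) \<le> s" if "l2 d x \<le> 1" "l2 e y \<le> 1" "l2 g z \<le> 1" for x y z
    unfolding s_def using that by (intro cSup_upper[OF _ bddV]) (auto simp: V_def)
  have s0: "0 \<le> s" using s[of "\<lambda>_. 0" "\<lambda>_. 0" "\<lambda>_. 0"] by (auto simp: z0 intro: order_trans[OF norm_ge_zero])
  have "s \<le> M + 3 / 4 * s"
    unfolding s_def
  proof (rule cSup_least[OF neV], fold s_def)
    fix v assume "v \<in> V"
    then obtain x y z where v: "v = cmod (T x y z)" and b: "l2 d x \<le> 1" "l2 e y \<le> 1" "l2 g z \<le> 1"
      by (auto simp: V_def)
    obtain x' where x': "x' \<in> X" "l2 d (\<lambda>i. x i - x' i) \<le> 1 / 4" using X(2)[OF b(1)] by blast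
    obtain y' where y': "y' \<in> Y" "l2 e (\<lambda>i. y i - y' i) \<le> 1 / 4" using Y(2)[OF b(2)] by blast
    obtain z' where z': "z' \<in> Z" "l2 g (\<lambda>i. z i - z' i) \<le> 1 / 4" using Z(2)[OF b(3)] by blast
    note b' = X(1)[OF x'(1)] Y(1)[OF y'(1)] Z(1)[OF z'(1)]
    have "cmod (T (\<lambda>i. x i - x' i) y z) \<le> s * l2 d (\<lambda>i. x i - x' i)"
      by (rule homogeneous_le[of "\<lambda>x. T x y z"]) (use s b hom in auto)
    also have "\<dots> \<le> s * (1 / 4)" using s0 x' by (intro mult_left_mono) auto
    finally have 1: "cmod (T (\<lambda>i. x i - x' i) y z) \<le> s / 4" by simp
    have "cmod (T x' (\<lambda>i. y i - y' i) z) \<le> s * l2 e (\<lambda>i. y i - y' i)"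
      by (rule homogeneous_le[of "\<lambda>y. T x' y z"]) (use s b b' hom in auto)
    also have "\<dots> \<le> s * (1 / 4)" using s0 y' by (intro mult_left_mono) auto
    finally have 2: "cmod (T x' (\<lambda>i. y i - y' i) z) \<le> s / 4" by simp
    have "cmod (T x' y' (\<lambda>i. z i - z' i)) \<le> s * l2 g (\<lambda>i. z i - z' i)"
      by (rule homogeneous_le[of "\<lambda>z. T x' y' z"]) (use s b b' hom in auto)
    also have "\<dots> \<le> s * (1 / 4)" using s0 z' by (intro mult_left_mono) auto
    finally have 3: "cmod (T x' y' (\<lambda>i. z i - z' i)) \<le> s / 4" by simp
    have eq: "T x y z = T x' y' z' + T (\<lambda>i. x i - x' i) y z + T x' (\<lambda>i. y i - y' i) z + T x' y' (\<lambda>i. z i - z' i)"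
      by (simp add: diff)
    have "cmod (T x y z) \<le> cmod (T x' y' z') + cmod (T (\<lambda>i. x i - x' i) y z)
        + cmod (T x' (\<lambda>i. y i - y' i) z) + cmod (T x' y' (\<lambda>i. z i - z' i))"
      by (subst eq) (intro norm_triangle_mono order_refl)
    then show "v \<le> M + 3 / 4 * s"
      using 1 2 3 M[OF x'(1) y'(1) z'(1)] by (simp add: v)
  qed
  then have "s \<le> 4 * M" by simp
  with s have b: "l2 d x \<le> 1 \<Longrightarrow> l2 e y \<le> 1 \<Longrightarrow> l2 g z \<le> 1 \<Longrightarrow> cmod (T x y z) \<le> 4 * M" for x y z
    by (meson order_trans)
  have c: "l2 d x \<le> 1 \<Longrightarrow> l2 e y \<le> 1 \<Longrightarrow> cmod (T x y z) \<le> 4 * M * l2 g z" for x y z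
    by (rule homogeneous_le[of "\<lambda>z. T x y z"]) (use b hom in auto)
  have "l2 d x \<le> 1 \<Longrightarrow> cmod (T x y z) \<le> (4 * M * l2 g z) * l2 e y" for x y z
    by (rule homogeneous_le[of "\<lambda>y. T x y z"]) (use c hom in auto)
  then have "cmod (T x y z) \<le> (4 * M * l2 g z * l2 e y) * l2 d x"
    by (intro homogeneous_le[of "\<lambda>x. T x y z"]) (use hom in auto)
  then show ?thesis by (simp add: mult_ac)
qed

section \<open>The Hilbert space $M_N$ and its reflections\<close>

lemma tr_inner_eq:
  assumes "x \<in> carrier_mat N N" "y \<in> carrier_mat N N"
  shows "tr_inner x y = (\<Sum>p\<in>{..<N} \<times> {..<N}. cnj (x $$ p) * y $$ p)"
proof -
  have "tr_inner x y = (\<Sum>j<N. \<Sum>i<N. cnj (x $$ (i, j)) * y $$ (i, j))"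
    unfolding tr_inner_def mat_trace_def
    using assms by (auto simp: mat_adjoint_def scalar_prod_def atLeast0LessThan mat_of_rows_def intro!: sum.cong)
  also have "\<dots> = (\<Sum>i<N. \<Sum>j<N. cnj (x $$ (i, j)) * y $$ (i, j))"
    by (rule sum.swap)
  finally show ?thesis by (simp add: sum.cartesian_product case_prod_unfold)
qed

lemma hs_sq_pairs: "x \<in> carrier_mat N N \<Longrightarrow> (hs x)\<^sup>2 = (\<Sum>p\<in>{..<N} \<times> {..<N}. (cmod (x $$ p))\<^sup>2)"
  by (simp add: hs_sq sum.cartesian_product case_prod_unfold)

lemma tr_inner_self: "x \<in> carrier_mat N N \<Longrightarrow> tr_inner x x = of_real ((hs x)\<^sup>2)"
  by (simp add: tr_inner_eq hs_sq_pairs complex_norm_square mult.commute del: of_real_power)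

lemma tr_inner_cnj:
  "x \<in> carrier_mat N N \<Longrightarrow> y \<in> carrier_mat N N \<Longrightarrow> tr_inner y x = cnj (tr_inner x y)"
  by (simp add: tr_inner_eq mult.commute)

lemma axpy_index:
  "y \<in> carrier_mat N N \<Longrightarrow> w \<in> carrier_mat N N \<Longrightarrow> p \<in> {..<N} \<times> {..<N} \<Longrightarrow>
    (y + a \<cdot>\<^sub>m w) $$ p = y $$ p + a * w $$ p"
  by auto

lemma tr_inner_axpy_right:
  assumes "x \<in> carrier_mat N N" "y \<in> carrier_mat N N" "w \<in> carrier_mat N N"
  shows "tr_inner x (y + a \<cdot>\<^sub>m w) = tr_inner x y + a * tr_inner x w"
proof -
  have "tr_inner x (y + a \<cdot>\<^sub>m w) = (\<Sum>p\<in>{..<N} \<times> {..<N}. cnj (x $$ p) * y $$ p + a * (cnj (x $$ p) * w $$ p))"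
    unfolding tr_inner_eq[OF assms(1) add_carrier_mat[OF smult_carrier_mat[OF assms(3)]]]
    by (intro sum.cong refl) (simp only: axpy_index[OF assms(2,3)] distrib_left mult.left_commute)
  then show ?thesis
    using assms by (simp only: tr_inner_eq sum.distrib sum_distrib_left)
qed

lemma tr_inner_axpy_left:
  assumes "x \<in> carrier_mat N N" "y \<in> carrier_mat N N" "w \<in> carrier_mat N N"
  shows "tr_inner (y + a \<cdot>\<^sub>m w) x = tr_inner y x + cnj a * tr_inner w x"
proof -
  have "tr_inner (y + a \<cdot>\<^sub>m w) x = cnj (tr_inner x (y + a \<cdot>\<^sub>m w))"
    by (rule tr_inner_cnj[OF assms(1)]) (use assms in simp)
  then show ?thesis
    using tr_inner_cnj[OF assms(1,2)] tr_inner_cnj[OF assms(1,3)] by (simp add: tr_inner_axpy_right[OF assms])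
qed

lemma tr_inner_smult_right:
  assumes "x \<in> carrier_mat N N" "y \<in> carrier_mat N N"
  shows "tr_inner x (a \<cdot>\<^sub>m y) = a * tr_inner x y"
  unfolding tr_inner_eq[OF assms] tr_inner_eq[OF assms(1) smult_carrier_mat[OF assms(2)]] sum_distrib_left
  using assms(2) by (intro sum.cong refl) auto

lemma tr_inner_smult_left:
  assumes "x \<in> carrier_mat N N" "y \<in> carrier_mat N N"
  shows "tr_inner (a \<cdot>\<^sub>m x) y = cnj a * tr_inner x y"
  using tr_inner_cnj[OF assms(2) smult_carrier_mat[OF assms(1)], of a] tr_inner_cnj[OF assms(2,1)]
  by (simp add: tr_inner_smult_right[OF assms(2,1)])

lemma hs_eq_0D:
  assumes "x \<in> carrier_mat N N" "hs x = 0" "i < N" "j < N"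
  shows "x $$ (i, j) = 0"
proof -
  have "(\<Sum>p\<in>{..<N} \<times> {..<N}. (cmod (x $$ p))\<^sup>2) = 0"
    using hs_sq_pairs[OF assms(1)] assms(2) by simp
  then show ?thesis
    using assms(3,4) by (subst (asm) sum_nonneg_eq_0_iff) auto
qed

text \<open>The unitary reflection $x \mapsto x - 2 \frac{\langle w, x\rangle}{\langle w, w\rangle} w$ in the
  hyperplane orthogonal to $w$. For $w = 0$ the quotient is $0$ and the reflection is the identity.\<close>

definition refl_coeff :: "complex mat \<Rightarrow> complex mat \<Rightarrow> complex" where
  "refl_coeff w x = - 2 * tr_inner w x / tr_inner w w"

definition reflection :: "nat \<Rightarrow> complex mat \<Rightarrow> complex mat \<Rightarrow> complex mat" where
  "reflection N w = (\<lambda>x\<in>carrier_mat N N. x + refl_coeff w x \<cdot>\<^sub>m w)"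

lemma reflection_carrier:
  "w \<in> carrier_mat N N \<Longrightarrow> x \<in> carrier_mat N N \<Longrightarrow> reflection N w x \<in> carrier_mat N N"
  by (simp add: reflection_def)

lemma reflection_involution:
  assumes w: "w \<in> carrier_mat N N" and x: "x \<in> carrier_mat N N"
  shows "reflection N w (reflection N w x) = x"
proof -
  have "refl_coeff w (x + refl_coeff w x \<cdot>\<^sub>m w) = - refl_coeff w x"
    unfolding refl_coeff_def tr_inner_axpy_right[OF w x w]
    by (cases "tr_inner w w = 0") (simp_all add: field_simps)
  then show ?thesis
    using w x by (auto simp: reflection_def intro!: eq_matI)
qed

lemma reflection_unitary:
  assumes w: "w \<in> carrier_mat N N"
  shows "reflection N w \<in> unitary_ops N"
proof -
  let ?H = "carrier_mat N N :: complex mat set"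
  have "mat_linear_on ?H (reflection N w)"
    unfolding mat_linear_on_def
  proof (intro conjI ballI allI)
    fix x y :: "complex mat" assume xy: "x \<in> ?H" "y \<in> ?H"
    have one: "1 \<cdot>\<^sub>m y = y" by (rule eq_matI) auto
    have "tr_inner w (x + y) = tr_inner w x + tr_inner w y"
      using tr_inner_axpy_right[OF w xy, of 1] one by simp
    then have "refl_coeff w (x + y) = refl_coeff w x + refl_coeff w y"
      by (simp add: refl_coeff_def add_divide_distrib distrib_left diff_divide_distrib)
    then show "reflection N w (x + y) = reflection N w x + reflection N w y"
      using xy w by (auto simp: reflection_def algebra_simps intro!: eq_matI)
  next
    fix a and x :: "complex mat" assume x: "x \<in> ?H"
    have "refl_coeff w (a \<cdot>\<^sub>m x) = a * refl_coeff w x"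
      using x w by (simp add: refl_coeff_def tr_inner_smult_right)
    then show "reflection N w (a \<cdot>\<^sub>m x) = a \<cdot>\<^sub>m reflection N w x"
      using x w by (auto simp: reflection_def algebra_simps intro!: eq_matI)
  qed
  moreover have "reflection N w ` ?H = ?H"
  proof (intro subset_antisym subsetI)
    fix x assume "x \<in> ?H"
    then show "x \<in> reflection N w ` ?H"
      using reflection_involution[OF w] reflection_carrier[OF w]
      by (intro image_eqI[where x = "reflection N w x"]) auto
  qed (use reflection_carrier[OF w] in auto)
  moreover have "tr_inner (reflection N w x) (reflection N w y) = tr_inner x y"
    if xy: "x \<in> ?H" "y \<in> ?H" for x y
  proof -
    define s where "s = tr_inner w w"
    have cs: "cnj s = s" unfolding s_def by (rule tr_inner_cnj[OF w w, symmetric])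
    have yw: "y + refl_coeff w y \<cdot>\<^sub>m w \<in> ?H" using xy w by simp
    have "tr_inner (reflection N w x) (reflection N w y)
        = tr_inner x y + refl_coeff w y * tr_inner x w
          + cnj (refl_coeff w x) * (tr_inner w y + refl_coeff w y * s)"
      using xy w yw
      by (simp add: reflection_def tr_inner_axpy_left[OF yw xy(1) w] tr_inner_axpy_right[of _ N] s_def)
    also have "cnj (refl_coeff w x) = - 2 * tr_inner x w / s"
      using tr_inner_cnj[OF w xy(1)] cs by (simp add: refl_coeff_def s_def)
    also have "tr_inner x y + refl_coeff w y * tr_inner x w
          + (- 2 * tr_inner x w / s) * (tr_inner w y + refl_coeff w y * s) = tr_inner x y"
      unfolding refl_coeff_def s_def[symmetric] by (cases "s = 0") (simp_all add: field_simps)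
    finally show ?thesis .
  qed
  ultimately show ?thesis
    using reflection_carrier[OF w] by (auto simp: unitary_ops_def reflection_def)
qed

text \<open>Take $w = z - v$. Reflections are self-adjoint, so $\langle z, v\rangle$ has to be real; then
  $\langle w, w\rangle = 2 \langle w, z\rangle$, and the coefficient of the reflection at $z$ is $-1$.\<close>

lemma exists_reflection_mapping:
  assumes z: "z \<in> carrier_mat N N" and v: "v \<in> carrier_mat N N" and n: "hs z = hs v"
    and r: "tr_inner z v \<in> \<real>"
  obtains w where "w \<in> carrier_mat N N" "reflection N w z = v"
proof
  define w where "w = z + (-1) \<cdot>\<^sub>m v"
  show w: "w \<in> carrier_mat N N" using z v by (simp add: w_def)
  have "tr_inner v z = tr_inner z v"
    using tr_inner_cnj[OF z v] r by (simp add: Reals_cnj_iff)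
  then have "tr_inner w w = 2 * tr_inner w z"
    using z v w n unfolding w_def
    by (simp add: tr_inner_axpy_left[of _ N] tr_inner_axpy_right[of _ N] tr_inner_self)
  then have c: "tr_inner w w \<noteq> 0 \<Longrightarrow> refl_coeff w z = - 1"
    by (simp add: refl_coeff_def)
  show "reflection N w z = v"
  proof (cases "tr_inner w w = 0")
    case False
    then have "reflection N w z = z + (-1) \<cdot>\<^sub>m w" using z by (simp only: reflection_def restrict_apply' c[OF False])
    then show ?thesis using z v by (auto simp: w_def intro!: eq_matI)
  next
    case True
    then have "hs w = 0" using tr_inner_self[OF w] by simp
    then have w0: "w $$ (i, j) = 0" if "i < N" "j < N" for i j using hs_eq_0D[OF w] that by blast
    show ?thesis
    proof (rule eq_matI)
      fix i j assume "i < dim_row v" "j < dim_col v"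
      then have ij: "i < N" "j < N" using v by auto
      have "z $$ (i, j) = v $$ (i, j)" using w0[OF ij] z v ij by (simp add: w_def)
      then show "reflection N w z $$ (i, j) = v $$ (i, j)"
        using z w ij w0[OF ij] by (simp add: reflection_def)
    qed (use z w v in \<open>auto simp: reflection_def\<close>)
  qed
qed

section \<open>Haar measure\<close>

lemma unitary_opsD:
  assumes "U \<in> unitary_ops N"
  shows "mat_linear_on (carrier_mat N N) U" "x \<in> carrier_mat N N \<Longrightarrow> U x \<in> carrier_mat N N"
    "x \<in> carrier_mat N N \<Longrightarrow> y \<in> carrier_mat N N \<Longrightarrow> tr_inner (U x) (U y) = tr_inner x y"
  using assms by (auto simp: unitary_ops_def)

lemma hs_unitary:
  assumes "U \<in> unitary_ops N" "x \<in> carrier_mat N N"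
  shows "hs (U x) = hs x"
proof -
  have "of_real ((hs (U x))\<^sup>2) = (of_real ((hs x)\<^sup>2) :: complex)"
    using unitary_opsD(3)[OF assms(1,2,2)]
    by (simp only: tr_inner_self[OF assms(2)] tr_inner_self[OF unitary_opsD(2)[OF assms]])
  then have "(hs (U x))\<^sup>2 = (hs x)\<^sup>2" by (simp only: of_real_eq_iff)
  then show ?thesis by (rule power2_eq_imp_eq) auto
qed

lemma compose_unitary:
  assumes "U \<in> unitary_ops N" "V \<in> unitary_ops N"
  shows "compose (carrier_mat N N) V U \<in> unitary_ops N"
proof -
  let ?H = "carrier_mat N N :: complex mat set" and ?W = "compose (carrier_mat N N) V U"
  have W: "?W x = V (U x)" if "x \<in> ?H" for x using that by (simp add: compose_def)
  note U = unitary_opsD[OF assms(1)] and V = unitary_opsD[OF assms(2)]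
  have "?W ` ?H = V ` (U ` ?H)" using W by (auto simp: image_image)
  also have "\<dots> = ?H" using assms by (simp add: unitary_ops_def)
  finally have im: "?W ` ?H = ?H" .
  have "?W (x + y) = ?W x + ?W y" if "x \<in> ?H" "y \<in> ?H" for x y
    using U(1,2) V(1) that by (simp add: W mat_linear_on_def)
  moreover have "?W (a \<cdot>\<^sub>m x) = a \<cdot>\<^sub>m ?W x" if "x \<in> ?H" for a x
    using U(1,2) V(1) that by (simp add: W mat_linear_on_def)
  moreover have "tr_inner (?W x) (?W y) = tr_inner x y" if "x \<in> ?H" "y \<in> ?H" for x y
    using U(2,3) V(3) that by (simp add: W)
  moreover have "?W \<in> ?H \<rightarrow>\<^sub>E ?H"
    using U(2) V(2) by (auto simp: compose_def)
  ultimately show ?thesis using im by (simp add: unitary_ops_def mat_linear_on_def)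
qed

lemma unitary_lincomb:
  assumes "U \<in> unitary_ops N" "d ` {..<n} \<subseteq> carrier_mat N N"
  shows "U (lincomb N n c d) = lincomb N n c (\<lambda>k. U (d k))"
proof (rule linear_lincomb(2)[OF unitary_opsD(1)[OF assms(1)] mat_subspace_carrier])
  show "U ` carrier_mat N N \<subseteq> carrier_mat N N" using unitary_opsD(2)[OF assms(1)] by blast
  show "\<And>k. k < n \<Longrightarrow> d k \<in> carrier_mat N N" using assms(2) by auto
qed

text \<open>The Borel structure of the unitary group is given by the matrix entries, so these are measurable
  at once.\<close>

lemma haar_measurable_entry:
  assumes \<mu>: "normalized_haar N \<mu>" and d: "d \<in> matrix_units N" and ij: "i < N" "j < N"
  shows "(\<lambda>U. U d $$ (i, j)) \<in> borel_measurable \<mu>"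
proof -
  obtain k l where kl: "k < N" "l < N" "d = mat_unit N k l" using d by (auto simp: matrix_units_def)
  have "op_entries N \<in> borel_measurable (unitary_borel N)"
    unfolding unitary_borel_def by (rule measurable_vimage_algebra1) simp
  moreover have "(\<lambda>f. f (i, j, k, l)) \<in> borel_measurable (borel :: (nat \<times> nat \<times> nat \<times> nat \<Rightarrow> complex) measure)"
    by (intro borel_measurable_continuous_onI) simp
  ultimately have "(\<lambda>U. op_entries N U (i, j, k, l)) \<in> borel_measurable (unitary_borel N)"
    by (rule measurable_compose)
  then have "(\<lambda>U. op_entries N U (i, j, k, l)) \<in> borel_measurable \<mu>"
    using \<mu> by (simp add: normalized_haar_def cong: measurable_cong_sets)
  then show ?thesis using kl ij by (simp add: op_entries_def)
qed

lemma haar_measurable_tr_inner: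
  assumes \<mu>: "normalized_haar N \<mu>" and d: "d ` {..<n} \<subseteq> matrix_units N" and z: "z \<in> carrier_mat N N"
  shows "(\<lambda>U. tr_inner z (U (lincomb N n c d))) \<in> borel_measurable \<mu>"
proof -
  have dc: "d ` {..<n} \<subseteq> carrier_mat N N"
    using d by (auto simp: matrix_units_def subset_iff)
  have "(\<lambda>U. \<Sum>p\<in>{..<N} \<times> {..<N}. cnj (z $$ p) * (\<Sum>k<n. c k * U (d k) $$ p)) \<in> borel_measurable \<mu>"
    using d haar_measurable_entry[OF \<mu>]
    by (intro borel_measurable_sum borel_measurable_times borel_measurable_const) auto
  moreover have "tr_inner z (U (lincomb N n c d))
      = (\<Sum>p\<in>{..<N} \<times> {..<N}. cnj (z $$ p) * (\<Sum>k<n. c k * U (d k) $$ p))" if "U \<in> space \<mu>" for U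
  proof -
    have U: "U \<in> unitary_ops N" using that \<mu> by (simp add: normalized_haar_def)
    have "U (lincomb N n c d) = lincomb N n c (\<lambda>k. U (d k))"
      by (rule unitary_lincomb[OF U dc])
    then show ?thesis
      unfolding tr_inner_eq[OF z unitary_opsD(2)[OF U lincomb_carrier]]
      by (intro sum.cong) (auto simp: lincomb_index)
  qed
  ultimately show ?thesis by (simp cong: measurable_cong)
qed

text \<open>A reflection $V$ maps $z$ to a multiple $\omega v$ with $|\omega| = 1$, the phase making the inner product
  real. As $V$ is unitary, left multiplication by $V$ maps the first event onto the event for
  $Vz = \omega v$, and the phase does not affect the modulus.\<close>

lemma haar_tail_invariant:
  assumes \<mu>: "normalized_haar N \<mu>" and d: "d ` {..<n} \<subseteq> matrix_units N"
    and z: "z \<in> carrier_mat N N" and v: "v \<in> carrier_mat N N" and n: "hs z = hs v"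
  shows "measure \<mu> {U \<in> space \<mu>. t \<le> cmod (tr_inner z (U (lincomb N n c d)))}
    = measure \<mu> {U \<in> space \<mu>. t \<le> cmod (tr_inner v (U (lincomb N n c d)))}"
proof -
  let ?H = "carrier_mat N N :: complex mat set"
  define y where "y = lincomb N n c d"
  have y: "y \<in> ?H" by (simp add: y_def)
  have sp: "space \<mu> = unitary_ops N" using \<mu> by (simp add: normalized_haar_def)
  define A where "A z = {U \<in> unitary_ops N. t \<le> cmod (tr_inner z (U y))}" for z
  have A: "A z \<in> sets \<mu>" if "z \<in> ?H" for z
    using haar_measurable_tr_inner[OF \<mu> d that, of c] unfolding A_def sp[symmetric] y_def by measurable
  define \<omega> where "\<omega> = (if tr_inner z v = 0 then 1 else cnj (tr_inner z v) / of_real (cmod (tr_inner z v)))"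
  have \<omega>: "cmod \<omega> = 1" by (simp add: \<omega>_def norm_divide)
  have \<omega>v: "\<omega> \<cdot>\<^sub>m v \<in> ?H" using v by simp
  have "tr_inner z (\<omega> \<cdot>\<^sub>m v) = of_real (cmod (tr_inner z v))"
    using complex_norm_square[of "tr_inner z v"]
    by (simp add: tr_inner_smult_right[OF z v] \<omega>_def field_simps power2_eq_square)
  then have r: "tr_inner z (\<omega> \<cdot>\<^sub>m v) \<in> \<real>" by simp
  have hn: "hs z = hs (\<omega> \<cdot>\<^sub>m v)"
    using v \<omega> n by (simp add: hs_def norm_mult)
  obtain w where w: "w \<in> ?H" and wz: "reflection N w z = \<omega> \<cdot>\<^sub>m v"
    using exists_reflection_mapping[OF z \<omega>v hn r] by blast
  let ?V = "reflection N w"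
  have V: "?V \<in> unitary_ops N" by (rule reflection_unitary[OF w])
  have Av: "A (\<omega> \<cdot>\<^sub>m v) = A v"
    unfolding A_def using unitary_opsD(2) y v \<omega>
    by (intro Collect_cong conj_cong refl) (simp add: tr_inner_smult_left[of _ N] norm_mult)
  have "compose ?H ?V ` A z = A (\<omega> \<cdot>\<^sub>m v)"
  proof (intro subset_antisym subsetI)
    fix U' assume "U' \<in> compose ?H ?V ` A z"
    then obtain U where U: "U \<in> unitary_ops N" "t \<le> cmod (tr_inner z (U y))" "U' = compose ?H ?V U"
      by (auto simp: A_def)
    have "tr_inner (\<omega> \<cdot>\<^sub>m v) (U' y) = tr_inner z (U y)"
      using unitary_opsD(3)[OF V z unitary_opsD(2)[OF U(1) y]] y by (simp add: U(3) compose_def wz)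
    then show "U' \<in> A (\<omega> \<cdot>\<^sub>m v)"
      using compose_unitary[OF U(1) V] U by (simp add: A_def)
  next
    fix U' assume "U' \<in> A (\<omega> \<cdot>\<^sub>m v)"
    then have U': "U' \<in> unitary_ops N" "t \<le> cmod (tr_inner (\<omega> \<cdot>\<^sub>m v) (U' y))" by (auto simp: A_def)
    let ?U = "compose ?H ?V U'"
    have "tr_inner z (?U y) = tr_inner (\<omega> \<cdot>\<^sub>m v) (U' y)"
      using unitary_opsD(3)[OF V z, of "?V (U' y)"] unitary_opsD(2)[OF U'(1) y] unitary_opsD(2)[OF V] y
      by (simp add: compose_def wz reflection_involution[OF w])
    then have "?U \<in> A z" using compose_unitary[OF U'(1) V] U' by (simp add: A_def)
    moreover have "compose ?H ?V ?U = U'"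
    proof
      fix x show "compose ?H ?V ?U x = U' x"
        using U'(1) unitary_opsD(2)[OF U'(1)] reflection_involution[OF w]
        by (cases "x \<in> ?H") (auto simp: compose_def unitary_ops_def PiE_iff extensional_def)
    qed
    ultimately show "U' \<in> compose ?H ?V ` A z" by (metis image_eqI)
  qed
  then have "emeasure \<mu> (A (\<omega> \<cdot>\<^sub>m v)) = emeasure \<mu> (A z)"
    using \<mu> V A[OF z] unfolding normalized_haar_def by metis
  then have "measure \<mu> (A z) = measure \<mu> (A v)" by (simp only: Av measure_def)
  then show ?thesis by (simp only: A_def sp y_def)
qed

text \<open>By invariance $z$ may be replaced by each vector with entries $\pm \|z\|_2 / N$. The average of these
  equal probabilities is the integral over $U$ of the proportion of sign vectors for which the event
  occurs, and for each $U$ that proportion is bounded by Hoeffding's inequality applied to the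
  entries of the unit ball element $U(y)$.\<close>

lemma haar_tail:
  assumes \<mu>: "normalized_haar N \<mu>" and N: "0 < N" and d: "d ` {..<n} \<subseteq> matrix_units N"
    and z: "z \<in> carrier_mat N N" "hs z \<le> 1" and y: "hs (lincomb N n c d) \<le> 1" and t: "0 \<le> t"
  shows "measure \<mu> {U \<in> space \<mu>. t \<le> cmod (tr_inner z (U (lincomb N n c d)))} \<le> 4 * exp (- (t * N)\<^sup>2 / 8)"
proof -
  interpret prob_space \<mu> using \<mu> by (simp add: normalized_haar_def)
  define I where "I = {..<N} \<times> {..<N}"
  have I: "finite I" "card I = N * N" by (auto simp: I_def)
  define y where "y = lincomb N n c d"
  define \<rho> where "\<rho> = hs z"
  define v where "v \<epsilon> = mat N N (\<lambda>p. complex_of_real (\<rho> / real N * \<epsilon> p))" for \<epsilon> :: "nat \<times> nat \<Rightarrow> real"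
  have v: "v \<epsilon> \<in> carrier_mat N N" for \<epsilon> by (simp add: v_def)
  have v_index: "v \<epsilon> $$ p = complex_of_real (\<rho> / real N * \<epsilon> p)" if "p \<in> I" for \<epsilon> p
    using that by (auto simp: v_def I_def)
  have hv: "hs (v \<epsilon>) = hs z" if \<epsilon>: "\<epsilon> \<in> signs I" for \<epsilon>
  proof -
    have "(hs (v \<epsilon>))\<^sup>2 = (\<Sum>p\<in>I. (\<rho> / real N)\<^sup>2)"
      unfolding hs_sq_pairs[OF v] I_def[symmetric]
    proof (rule sum.cong[OF refl])
      fix p assume p: "p \<in> I"
      then have "\<epsilon> p = -1 \<or> \<epsilon> p = 1" using \<epsilon> by (auto simp: PiE_iff)
      then show "(cmod (v \<epsilon> $$ p))\<^sup>2 = (\<rho> / real N)\<^sup>2"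
        unfolding v_index[OF p] by (auto simp: norm_mult norm_divide power_divide)
    qed
    also have "\<dots> = (hs z)\<^sup>2" using N by (simp add: I \<rho>_def power2_eq_square)
    finally show ?thesis by (rule power2_eq_imp_eq) auto
  qed
  define A where "A z = {U \<in> space \<mu>. t \<le> cmod (tr_inner z (U y))}" for z
  have A: "A z \<in> sets \<mu>" if "z \<in> carrier_mat N N" for z
    using haar_measurable_tr_inner[OF \<mu> d that, of c] unfolding A_def y_def by measurable
  have eq: "measure \<mu> (A z) = measure \<mu> (A (v \<epsilon>))" if "\<epsilon> \<in> signs I" for \<epsilon>
    unfolding A_def y_def by (rule haar_tail_invariant[OF \<mu> d z(1) v]) (simp add: hv[OF that])
  define b where "b = 4 * exp (- (t * N)\<^sup>2 / 8)"
  have fin: "finite (signs I)" using I by (intro finite_PiE) auto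
  have le: "(\<Sum>\<epsilon>\<in>signs I. indicator (A (v \<epsilon>)) U) \<le> 2 ^ card I * b" if U: "U \<in> space \<mu>" for U
  proof -
    have Uo: "U \<in> unitary_ops N" using U \<mu> by (simp add: normalized_haar_def)
    have yc: "y \<in> carrier_mat N N" by (simp add: y_def)
    have Uy: "U y \<in> carrier_mat N N" using unitary_opsD(2)[OF Uo yc] .
    have "(\<Sum>p\<in>I. (cmod (U y $$ p))\<^sup>2) = (hs y)\<^sup>2"
      unfolding I_def hs_sq_pairs[OF Uy, symmetric] hs_unitary[OF Uo yc] ..
    also have "\<dots> \<le> 1" using y power_le_one[of "hs y" 2] by (simp add: y_def)
    finally have s1: "(\<Sum>p\<in>I. (cmod (U y $$ p))\<^sup>2) \<le> 1" .
    have "(\<Sum>\<epsilon>\<in>signs I. indicator (A (v \<epsilon>)) U :: real) = real (card {\<epsilon> \<in> signs I. U \<in> A (v \<epsilon>)})"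
      using fin by (simp add: indicator_def sum.If_cases Int_def)
    also have "\<dots> \<le> real (card {\<epsilon> \<in> signs I. t * N \<le> cmod (\<Sum>p\<in>I. of_real (\<epsilon> p) * U y $$ p)})"
    proof (intro of_nat_mono card_mono)
      show "{\<epsilon> \<in> signs I. U \<in> A (v \<epsilon>)} \<subseteq> {\<epsilon> \<in> signs I. t * N \<le> cmod (\<Sum>p\<in>I. of_real (\<epsilon> p) * U y $$ p)}"
      proof clarify
        fix \<epsilon> assume "U \<in> A (v \<epsilon>)"
        then have "t \<le> cmod (tr_inner (v \<epsilon>) (U y))" by (simp add: A_def)
        also have "tr_inner (v \<epsilon>) (U y) = of_real (\<rho> / real N) * (\<Sum>p\<in>I. of_real (\<epsilon> p) * U y $$ p)"
          unfolding tr_inner_eq[OF v Uy] I_def[symmetric] sum_distrib_left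
          by (intro sum.cong refl) (simp add: v_index)
        also have "cmod \<dots> = \<rho> / real N * cmod (\<Sum>p\<in>I. of_real (\<epsilon> p) * U y $$ p)"
          by (simp add: norm_mult norm_divide \<rho>_def)
        also have "\<dots> \<le> 1 / real N * cmod (\<Sum>p\<in>I. of_real (\<epsilon> p) * U y $$ p)"
          using z(2) by (intro mult_right_mono divide_right_mono) (auto simp: \<rho>_def)
        finally show "t * N \<le> cmod (\<Sum>p\<in>I. of_real (\<epsilon> p) * U y $$ p)"
          using N by (simp add: field_simps)
      qed
    qed (use fin in auto)
    also have "\<dots> \<le> 2 ^ card I * b"
      unfolding b_def by (rule card_signs_cmod_ge[OF I(1) s1]) (use t in auto)
    finally show ?thesis .
  qed
  have "2 ^ card I * measure \<mu> (A z) = (\<Sum>\<epsilon>\<in>signs I. measure \<mu> (A (v \<epsilon>)))"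
  proof -
    have "(\<Sum>\<epsilon>\<in>signs I. measure \<mu> (A (v \<epsilon>))) = (\<Sum>\<epsilon>\<in>signs I. measure \<mu> (A z))"
      by (rule sum.cong[OF refl]) (rule eq[symmetric])
    then show ?thesis by (simp add: card_signs[OF I(1)])
  qed
  also have "\<dots> = (\<Sum>\<epsilon>\<in>signs I. \<integral>U. indicator (A (v \<epsilon>)) U \<partial>\<mu>)"
    using A[OF v] sets.sets_into_space by (intro sum.cong refl) (simp add: Int_absorb2)
  also have "\<dots> = (\<integral>U. (\<Sum>\<epsilon>\<in>signs I. indicator (A (v \<epsilon>)) U) \<partial>\<mu>)"
    using A[OF v] by (intro Bochner_Integration.integral_sum[symmetric]) (simp add: emeasure_eq_measure)
  also have "\<dots> \<le> (\<integral>U. 2 ^ card I * b \<partial>\<mu>)"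
    using A[OF v] le by (intro integral_mono Bochner_Integration.integrable_sum) (auto simp: emeasure_eq_measure)
  also have "\<dots> = 2 ^ card I * b" by (simp add: prob_space)
  finally have "measure \<mu> (A z) \<le> b" by simp
  then show ?thesis by (simp add: A_def b_def y_def)
qed

section \<open>Measurability of the 1-summing norm of a random subspace\<close>

lemma block_sum_swap:
  "(\<Sum>i<r. \<Sum>j<r. \<Sum>p<N. \<Sum>q<N. \<Sum>l<m. F i j p q l)
    = (\<Sum>l<m. \<Sum>p<N. \<Sum>q<N. \<Sum>i<r. \<Sum>j<r. F i j p q l)"
  for F :: "nat \<Rightarrow> nat \<Rightarrow> nat \<Rightarrow> nat \<Rightarrow> nat \<Rightarrow> 'a::comm_monoid_add"
  unfolding sum.cartesian_product
  by (rule sum.reindex_bij_witness[where i = "\<lambda>(l, p, q, i, j). (i, j, p, q, l)"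
        and j = "\<lambda>(i, j, p, q, l). (l, p, q, i, j)"]) auto

lemma bil_block_lincomb:
  assumes "\<And>i j. i < r \<Longrightarrow> j < r \<Longrightarrow> v i j = lincomb N m (\<lambda>l. x i j $$ (l, l)) g"
  shows "bil (block_mat r N v) \<xi> \<eta> = (\<Sum>l<m. \<Sum>p<N. \<Sum>q<N.
    g l $$ (p, q) * (\<Sum>i<r. \<Sum>j<r. \<xi> (i * N + p) * x i j $$ (l, l) * \<eta> (j * N + q)))"
proof -
  have "bil (block_mat r N v) \<xi> \<eta> = (\<Sum>i<r. \<Sum>j<r. \<Sum>p<N. \<Sum>q<N. \<Sum>l<m.
      g l $$ (p, q) * (\<xi> (i * N + p) * x i j $$ (l, l) * \<eta> (j * N + q)))"
    unfolding bil_block_mat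
    by (intro sum.cong refl)
       (simp add: assms lincomb_index sum_distrib_left sum_distrib_right mult_ac)
  then show ?thesis by (simp only: block_sum_swap sum_distrib_left)
qed

text \<open>The scalar $r$ allows for the rescaling in the proof of \<open>pi_1cb_gt_open\<close>.\<close>

lemma opnorm_perturb:
  assumes A: "A \<in> carrier_mat p q" and B: "B \<in> carrier_mat p q" and r: "0 \<le> r"
  shows "opnorm A \<le> r * opnorm B + (\<Sum>i<p. \<Sum>j<q. cmod (A $$ (i, j) - of_real r * B $$ (i, j)))"
proof (rule opnorm_le)
  fix \<xi> \<eta> :: "nat \<Rightarrow> complex"
  define D where "D = mat p q (\<lambda>ij. A $$ ij - of_real r * B $$ ij)"
  have "bil A \<xi> \<eta> = of_real r * bil B \<xi> \<eta> + bil D \<xi> \<eta>"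
    using A B by (simp add: bil_def D_def sum_distrib_left sum.distrib[symmetric] algebra_simps)
  then have "cmod (bil A \<xi> \<eta>) \<le> r * cmod (bil B \<xi> \<eta>) + cmod (bil D \<xi> \<eta>)"
    using r norm_triangle_ineq[of "of_real r * bil B \<xi> \<eta>" "bil D \<xi> \<eta>"] by (simp add: norm_mult)
  also have "\<dots> \<le> r * (opnorm B * l2 p \<xi> * l2 q \<eta>) + opnorm D * l2 p \<xi> * l2 q \<eta>"
    using bil_le_opnorm[of B \<xi> \<eta>] bil_le_opnorm[of D \<xi> \<eta>] B r
    by (intro add_mono mult_left_mono) (auto simp: D_def)
  also have "\<dots> = (r * opnorm B + opnorm D) * (l2 p \<xi> * l2 q \<eta>)"
    by (simp add: algebra_simps)
  also have "\<dots> \<le> (r * opnorm B + (\<Sum>i<p. \<Sum>j<q. cmod (D $$ (i, j)))) * (l2 p \<xi> * l2 q \<eta>)"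
    using opnorm_le_sum_entries[of D p q] by (intro mult_right_mono add_left_mono) (auto simp: D_def)
  finally show "cmod (bil A \<xi> \<eta>) \<le> (r * opnorm B
      + (\<Sum>i<p. \<Sum>j<q. cmod (A $$ (i, j) - of_real r * B $$ (i, j)))) * l2 (dim_row A) \<xi> * l2 (dim_col A) \<eta>"
    using A by (simp add: D_def mult.assoc)
qed (use r in \<open>auto intro!: add_nonneg_nonneg mult_nonneg_nonneg sum_nonneg opnorm_nonneg\<close>)

text \<open>A map $u$ that witnesses $\pi_{1,cb} > C$ for the span of $X$ is given by coefficients with respect to
  $X$. The same coefficients define a map into the span of $X'$ whose cb norm is at most $1 + \epsilon$ if
  the images of the unit vectors move by less than $\epsilon$ in total. Division by $1 + \epsilon$ makes it
  completely contractive, and the strict inequality survives for small $\epsilon$. Coefficients that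
  serve for all nearby $X'$ are needed, hence they are chosen before $X'$.\<close>

lemma pi_1cb_gt_open:
  assumes C: "0 \<le> C" and gt: "ennreal C < pi_1cb N (mat_span N n X) opnorm id"
  shows "\<exists>(m::nat) (c::nat \<Rightarrow> nat \<Rightarrow> complex) \<epsilon>. 0 < \<epsilon> \<and> (\<forall>X'.
    (\<Sum>l<m. \<Sum>i<N. \<Sum>j<N. cmod (lincomb N n (c l) X' $$ (i, j) - lincomb N n (c l) X $$ (i, j))) < \<epsilon> \<longrightarrow>
      ennreal C < pi_1cb N (mat_span N n X') opnorm id)"
proof -
  from gt obtain m u where u: "mat_linear_on (linf m) u" "u ` linf m \<subseteq> mat_span N n X"
    "cb_norm m (linf m) N u \<le> 1" and su: "ennreal C < ennreal (\<Sum>k<m. opnorm (u (mat_unit m k k)))"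
    unfolding pi_1cb_def less_Sup_iff by auto
  have uc: "u ` linf m \<subseteq> carrier_mat N N" using u(2) mat_span_carrier by blast
  have "\<forall>l. \<exists>c. u (mat_unit m l l) = lincomb N n c X"
    using subsetD[OF u(2) imageI[OF mat_unit_linf]] by (auto simp: mat_span_lincomb)
  then obtain c where c: "\<And>l. u (mat_unit m l l) = lincomb N n (c l) X" by metis
  define a where "a l = lincomb N n (c l) X" for l
  define s where "s = (\<Sum>l<m. opnorm (a l))"
  have sC: "C < s" using su C by (simp add: s_def a_def c[symmetric] ennreal_less_iff)
  \<comment> \<open>Small enough for $(s - \epsilon) / (1 + \epsilon) > C$.\<close>
  define \<epsilon> where "\<epsilon> = (s - C) / 2 / (1 + C)"
  have \<epsilon>: "0 < \<epsilon>" using sC C by (simp add: \<epsilon>_def)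
  have eq: "(s - C) / 2 = \<epsilon> * (1 + C)"
    using iffD1[OF nonzero_divide_eq_eq \<epsilon>_def[symmetric]] C by linarith
  have \<epsilon>C: "\<epsilon> * (1 + C) < s - C" unfolding eq[symmetric] using sC by simp
  show ?thesis
  proof (rule exI[of _ m], rule exI[of _ c], rule exI[of _ \<epsilon>], intro conjI allI impI \<epsilon>)
    fix X' :: "nat \<Rightarrow> complex mat"
    define b where "b l = lincomb N n (c l) X'" for l
    define e where "e = (\<Sum>l<m. \<Sum>i<N. \<Sum>j<N. cmod (b l $$ (i, j) - a l $$ (i, j)))"
    assume "(\<Sum>l<m. \<Sum>i<N. \<Sum>j<N. cmod (lincomb N n (c l) X' $$ (i, j) - lincomb N n (c l) X $$ (i, j))) < \<epsilon>"
    then have e: "e < \<epsilon>" by (simp add: e_def a_def b_def)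
    define \<kappa> where "\<kappa> = 1 / (1 + \<epsilon>)"
    have \<kappa>: "0 < \<kappa>" "\<kappa> * (1 + \<epsilon>) = 1" using \<epsilon> by (auto simp: \<kappa>_def)
    define g where "g l = of_real \<kappa> \<cdot>\<^sub>m b l" for l
    have ab: "a l \<in> carrier_mat N N" "b l \<in> carrier_mat N N" "g l \<in> carrier_mat N N" for l
      by (simp_all add: a_def b_def g_def)
    have g_index: "g l $$ (i, j) = of_real \<kappa> * b l $$ (i, j)" if "i < N" "j < N" for l i j
      using ab(2)[of l] that by (simp add: g_def)
    define u' where "u' d = lincomb N m (\<lambda>l. d $$ (l, l)) g" for d :: "complex mat"
    have u'_unit: "u' (mat_unit m k k) = g k" if "k < m" for k
    proof (rule eq_matI)
      fix i j assume "i < dim_row (g k)" "j < dim_col (g k)"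
      then have ij: "i < N" "j < N" using ab(3)[of k] by auto
      have "u' (mat_unit m k k) $$ (i, j) = (\<Sum>l<m. if l = k then g k $$ (i, j) else 0)"
        unfolding u'_def lincomb_index[OF ij] by (intro sum.cong) (auto simp: mat_unit_def)
      then show "u' (mat_unit m k k) $$ (i, j) = g k $$ (i, j)" using that by simp
    qed (use ab(3)[of k] in \<open>auto simp: u'_def\<close>)
    have "mat_linear_on (linf m) u'"
      unfolding mat_linear_on_def
    proof (intro conjI ballI allI)
      fix x y assume "x \<in> linf m" "y \<in> linf m"
      then have "x \<in> carrier_mat m m" "y \<in> carrier_mat m m" by (auto simp: linf_def)
      then show "u' (x + y) = u' x + u' y"
        by (intro eq_matI) (auto simp: u'_def lincomb_index sum.distrib distrib_right cong: sum.cong_simp)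
    next
      fix t x assume "x \<in> linf m"
      then have "x \<in> carrier_mat m m" by (auto simp: linf_def)
      then show "u' (t \<cdot>\<^sub>m x) = t \<cdot>\<^sub>m u' x"
        by (intro eq_matI) (auto simp: u'_def lincomb_index sum_distrib_left mult.assoc cong: sum.cong_simp)
    qed
    moreover have "u' ` linf m \<subseteq> mat_span N n X'"
    proof clarify
      fix d
      have "u' d = lincomb N n (\<lambda>k. \<Sum>l<m. d $$ (l, l) * of_real \<kappa> * c l k) X'"
      proof (rule eq_matI)
        fix i j assume "i < dim_row (lincomb N n (\<lambda>k. \<Sum>l<m. d $$ (l, l) * of_real \<kappa> * c l k) X')"
          "j < dim_col (lincomb N n (\<lambda>k. \<Sum>l<m. d $$ (l, l) * of_real \<kappa> * c l k) X')"
        then have ij: "i < N" "j < N" by auto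
        have "u' d $$ (i, j) = (\<Sum>l<m. \<Sum>k<n. d $$ (l, l) * of_real \<kappa> * c l k * X' k $$ (i, j))"
          using ij by (simp add: u'_def lincomb_index g_def b_def sum_distrib_left mult.assoc)
        also have "\<dots> = (\<Sum>k<n. \<Sum>l<m. d $$ (l, l) * of_real \<kappa> * c l k * X' k $$ (i, j))"
          by (rule sum.swap)
        finally show "u' d $$ (i, j) = lincomb N n (\<lambda>k. \<Sum>l<m. d $$ (l, l) * of_real \<kappa> * c l k) X' $$ (i, j)"
          using ij by (simp add: lincomb_index sum_distrib_right)
      qed (auto simp: u'_def)
      then show "u' d \<in> mat_span N n X'" by (simp add: lincomb_in_span)
    qed
    moreover have "cb_norm m (linf m) N u' \<le> 1"
      unfolding cb_norm_def
    proof (rule Sup_least, clarify)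
      fix r x assume x: "\<forall>i<r. \<forall>j<r. x i j \<in> linf m" and x1: "opnorm (block_mat r m x) \<le> 1"
      have "opnorm (block_mat r N (\<lambda>i j. u' (x i j))) \<le> 1"
      proof (rule opnorm_le)
        fix \<xi> \<eta> :: "nat \<Rightarrow> complex"
        define Z where "Z l p q = (\<Sum>i<r. \<Sum>j<r. \<xi> (i * N + p) * x i j $$ (l, l) * \<eta> (j * N + q))" for l p q
        define R where "R = (\<Sum>l<m. \<Sum>p<N. \<Sum>q<N. (b l $$ (p, q) - a l $$ (p, q)) * Z l p q)"
        let ?n = "l2 (r * N) \<xi> * l2 (r * N) \<eta>"
        have 1: "bil (block_mat r N (\<lambda>i j. u (x i j))) \<xi> \<eta> = (\<Sum>l<m. \<Sum>p<N. \<Sum>q<N. a l $$ (p, q) * Z l p q)"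
          unfolding Z_def using x linear_on_linf[OF u(1) uc]
          by (intro bil_block_lincomb) (simp add: c a_def)
        have "bil (block_mat r N (\<lambda>i j. u' (x i j))) \<xi> \<eta> = (\<Sum>l<m. \<Sum>p<N. \<Sum>q<N. g l $$ (p, q) * Z l p q)"
          unfolding Z_def by (intro bil_block_lincomb) (simp add: u'_def)
        also have "\<dots> = (\<Sum>l<m. \<Sum>p<N. \<Sum>q<N. of_real \<kappa> *
            (a l $$ (p, q) * Z l p q + (b l $$ (p, q) - a l $$ (p, q)) * Z l p q))"
          by (intro sum.cong refl) (simp add: g_index algebra_simps)
        also have "\<dots> = of_real \<kappa> * (bil (block_mat r N (\<lambda>i j. u (x i j))) \<xi> \<eta> + R)"
          by (simp only: 1 R_def sum.distrib sum_distrib_left[symmetric])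
        finally have "cmod (bil (block_mat r N (\<lambda>i j. u' (x i j))) \<xi> \<eta>)
            = \<kappa> * cmod (bil (block_mat r N (\<lambda>i j. u (x i j))) \<xi> \<eta> + R)"
          using \<kappa> by (simp add: norm_mult)
        also have "\<dots> \<le> \<kappa> * (?n + e * ?n)"
        proof (intro mult_left_mono order_trans[OF norm_triangle_ineq] add_mono)
          have "cmod (bil (block_mat r N (\<lambda>i j. u (x i j))) \<xi> \<eta>)
              \<le> opnorm (block_mat r N (\<lambda>i j. u (x i j))) * ?n"
            using bil_le_opnorm[of "block_mat r N (\<lambda>i j. u (x i j))" \<xi> \<eta>] by (simp add: mult.assoc)
          also have "\<dots> \<le> 1 * ?n"
            using x x1 by (intro mult_right_mono cb_norm_le_1D[OF u(3)]) auto
          finally show "cmod (bil (block_mat r N (\<lambda>i j. u (x i j))) \<xi> \<eta>) \<le> ?n" by simp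
          have "cmod R \<le> (\<Sum>l<m. \<Sum>p<N. \<Sum>q<N. cmod (b l $$ (p, q) - a l $$ (p, q)) * ?n)"
            unfolding R_def
          proof (intro sum_norm_le)
            fix l p q assume l: "l \<in> {..<m}" and pq: "p \<in> {..<N}" "q \<in> {..<N}"
            have "cmod (Z l p q) \<le> l2 r (\<lambda>i. \<xi> (i * N + p)) * l2 r (\<lambda>j. \<eta> (j * N + q))"
              unfolding Z_def using l by (intro linf_block_slice[OF x1]) auto
            also have "\<dots> \<le> ?n" using pq by (intro mult_mono l2_block_le) auto
            finally show "cmod ((b l $$ (p, q) - a l $$ (p, q)) * Z l p q) \<le> cmod (b l $$ (p, q) - a l $$ (p, q)) * ?n"
              unfolding norm_mult by (intro mult_left_mono) auto
          qed
          then show "cmod R \<le> e * ?n" by (simp only: e_def sum_distrib_right)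
        qed (use \<kappa> in simp)
        also have "\<dots> = (\<kappa> * (1 + e)) * ?n" by (simp add: algebra_simps)
        also have "\<dots> \<le> 1 * ?n"
        proof (rule mult_right_mono)
          have "\<kappa> * (1 + e) \<le> \<kappa> * (1 + \<epsilon>)" using e \<kappa>(1) by (intro mult_left_mono) auto
          then show "\<kappa> * (1 + e) \<le> 1" by (simp only: \<kappa>(2))
        qed simp
        finally show "cmod (bil (block_mat r N (\<lambda>i j. u' (x i j))) \<xi> \<eta>)
            \<le> 1 * l2 (dim_row (block_mat r N (\<lambda>i j. u' (x i j)))) \<xi> * l2 (dim_col (block_mat r N (\<lambda>i j. u' (x i j)))) \<eta>"
          by simp
      qed simp
      then show "ennreal (opnorm (block_mat r N (\<lambda>i j. u' (x i j)))) \<le> 1" by simp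
    qed
    ultimately have le: "ennreal (\<Sum>k<m. opnorm (id (u' (mat_unit m k k)))) \<le> pi_1cb N (mat_span N n X') opnorm id"
      unfolding pi_1cb_def by (intro Sup_upper) blast
    have "s \<le> (\<Sum>l<m. (1 + \<epsilon>) * opnorm (g l) + (\<Sum>i<N. \<Sum>j<N. cmod (b l $$ (i, j) - a l $$ (i, j))))"
      unfolding s_def
    proof (rule sum_mono)
      fix l
      have "of_real (1 + \<epsilon>) * g l $$ (i, j) = b l $$ (i, j)" if "i < N" "j < N" for i j
      proof -
        have "of_real (1 + \<epsilon>) * g l $$ (i, j) = of_real (\<kappa> * (1 + \<epsilon>)) * b l $$ (i, j)"
          by (simp add: g_index[OF that] algebra_simps)
        then show ?thesis using \<kappa>(2) by simp
      qed
      then have "(\<Sum>i<N. \<Sum>j<N. cmod (a l $$ (i, j) - of_real (1 + \<epsilon>) * g l $$ (i, j)))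
          = (\<Sum>i<N. \<Sum>j<N. cmod (b l $$ (i, j) - a l $$ (i, j)))"
        by (intro sum.cong refl) (simp add: norm_minus_commute)
      then show "opnorm (a l) \<le> (1 + \<epsilon>) * opnorm (g l) + (\<Sum>i<N. \<Sum>j<N. cmod (b l $$ (i, j) - a l $$ (i, j)))"
        using opnorm_perturb[OF ab(1) ab(3), of "1 + \<epsilon>" l l] \<epsilon> by simp
    qed
    also have "\<dots> = (1 + \<epsilon>) * (\<Sum>l<m. opnorm (g l)) + e"
      by (simp add: sum.distrib sum_distrib_left e_def)
    finally have "(1 + \<epsilon>) * C < (1 + \<epsilon>) * (\<Sum>l<m. opnorm (g l))"
      using e \<epsilon>C by (simp add: algebra_simps)
    then have "C < (\<Sum>l<m. opnorm (g l))" using \<epsilon> by (simp add: mult_less_cancel_left_pos)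
    then have "ennreal C < ennreal (\<Sum>k<m. opnorm (id (u' (mat_unit m k k))))"
      using C u'_unit by (simp add: ennreal_less_iff)
    then show "ennreal C < pi_1cb N (mat_span N n X') opnorm id" using le by (rule less_le_trans)
  qed
qed

lemma matrix_units_indexing:
  assumes "y ` {..<n} \<subseteq> matrix_units N"
  obtains P where "\<And>k. k < n \<Longrightarrow> P k \<in> {..<N} \<times> {..<N}"
    "\<And>k. k < n \<Longrightarrow> y k = mat_unit N (fst (P k)) (snd (P k))"
proof -
  have "\<forall>k\<in>{..<n}. \<exists>p. p \<in> {..<N} \<times> {..<N} \<and> y k = mat_unit N (fst p) (snd p)"
    using assms by (force simp: matrix_units_def subset_iff)
  then show ?thesis using that by (metis bchoice lessThan_iff)
qed

text \<open>The spaces with $\pi_{1,cb} > C$ correspond to an open set of matrix entries by the previous lemma.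
  Openness avoids a measurable selection of the maps in the uncountable supremum.\<close>

lemma pi_1cb_sets:
  assumes \<mu>: "normalized_haar N \<mu>" and y: "y ` {..<n} \<subseteq> matrix_units N" and C: "0 \<le> C"
  shows "{U \<in> space \<mu>. pi_1cb N (mat_span N n (\<lambda>k. U (y k))) opnorm id \<le> ennreal C} \<in> sets \<mu>"
proof -
  obtain P where P: "\<And>k. k < n \<Longrightarrow> P k \<in> {..<N} \<times> {..<N}"
    and yP: "\<And>k. k < n \<Longrightarrow> y k = mat_unit N (fst (P k)) (snd (P k))"
    using matrix_units_indexing[OF y] by blast
  have sp: "space \<mu> = unitary_ops N" using \<mu> by (simp add: normalized_haar_def)
  define S where "S = {U \<in> unitary_ops N. ennreal C < pi_1cb N (mat_span N n (\<lambda>k. U (y k))) opnorm id}"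
  have entry: "lincomb N n c (\<lambda>k. U (y k)) $$ (i, j)
      = (\<Sum>k<n. c k * op_entries N U (i, j, fst (P k), snd (P k)))" if "i < N" "j < N" for U c i j
    unfolding lincomb_index[OF that]
  proof (rule sum.cong[OF refl])
    fix k assume "k \<in> {..<n}"
    then show "c k * U (y k) $$ (i, j) = c k * op_entries N U (i, j, fst (P k), snd (P k))"
      using that P[of k] yP[of k] by (cases "P k") (simp add: op_entries_def)
  qed
  have "\<exists>W. open W \<and> op_entries N U \<in> W \<and> (\<forall>U'\<in>unitary_ops N. op_entries N U' \<in> W \<longrightarrow> U' \<in> S)"
    if U: "U \<in> S" for U
  proof -
    from U have gt: "ennreal C < pi_1cb N (mat_span N n (\<lambda>k. U (y k))) opnorm id" by (simp add: S_def)
    from pi_1cb_gt_open[OF C gt] obtain m :: nat and c :: "nat \<Rightarrow> nat \<Rightarrow> complex" and \<epsilon>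
      where \<epsilon>: "0 < \<epsilon>" and near: "\<forall>X'. (\<Sum>l<m. \<Sum>i<N. \<Sum>j<N.
        cmod (lincomb N n (c l) X' $$ (i, j) - lincomb N n (c l) (\<lambda>k. U (y k)) $$ (i, j))) < \<epsilon> \<longrightarrow>
        ennreal C < pi_1cb N (mat_span N n X') opnorm id"
      by blast
    define W where "W = {f. (\<Sum>l<m. \<Sum>i<N. \<Sum>j<N. cmod ((\<Sum>k<n. c l k * f (i, j, fst (P k), snd (P k)))
      - lincomb N n (c l) (\<lambda>k. U (y k)) $$ (i, j))) < \<epsilon>}"
    have "open W"
      unfolding W_def by (intro open_Collect_less continuous_intros continuous_on_product_coordinates)
    moreover have "op_entries N U \<in> W" using \<epsilon> by (simp add: W_def entry)
    moreover have "U' \<in> S" if "U' \<in> unitary_ops N" "op_entries N U' \<in> W" for U'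
      using that near[rule_format, of "\<lambda>k. U' (y k)"] by (simp add: W_def S_def entry)
    ultimately show ?thesis by blast
  qed
  then obtain W where W: "\<And>U. U \<in> S \<Longrightarrow> open (W U)" "\<And>U. U \<in> S \<Longrightarrow> op_entries N U \<in> W U"
    "\<And>U U'. U \<in> S \<Longrightarrow> U' \<in> unitary_ops N \<Longrightarrow> op_entries N U' \<in> W U \<Longrightarrow> U' \<in> S"
    by metis
  have "S = op_entries N -` (\<Union>U\<in>S. W U) \<inter> unitary_ops N"
    using W(2,3) by (auto simp: S_def)
  moreover have "(\<Union>U\<in>S. W U) \<in> sets borel" using W(1) by (intro borel_open) auto
  ultimately have "S \<in> sets (unitary_borel N)"
    unfolding unitary_borel_def by (metis in_vimage_algebra)
  then have "S \<in> sets \<mu>" using \<mu> by (simp add: normalized_haar_def)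
  then have "space \<mu> - S \<in> sets \<mu>" by (rule sets.compl_sets)
  also have "space \<mu> - S = {U \<in> space \<mu>. pi_1cb N (mat_span N n (\<lambda>k. U (y k))) opnorm id \<le> ennreal C}"
    by (auto simp: S_def sp not_less)
  finally show ?thesis .
qed

section \<open>The union bound\<close>

text \<open>Distinct matrix units are orthonormal.\<close>

lemma hs_lincomb_units:
  assumes y: "y ` {..<n} \<subseteq> matrix_units N" and inj: "inj_on y {..<n}"
  shows "hs (lincomb N n c y) = l2 n c"
proof -
  obtain P where P: "\<And>k. k < n \<Longrightarrow> P k \<in> {..<N} \<times> {..<N}"
    and yP: "\<And>k. k < n \<Longrightarrow> y k = mat_unit N (fst (P k)) (snd (P k))"
    using matrix_units_indexing[OF y] by blast
  have injP: "inj_on P {..<n}"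
    using inj yP by (metis (no_types, lifting) inj_on_def lessThan_iff)
  have entry: "lincomb N n c y $$ p = (\<Sum>k<n. if P k = p then c k else 0)" if pN: "p \<in> {..<N} \<times> {..<N}" for p
  proof -
    obtain i j where p: "p = (i, j)" "i < N" "j < N" using pN by (cases p) auto
    have "c k * y k $$ (i, j) = (if P k = (i, j) then c k else 0)" if "k < n" for k
      using p yP[OF that] by (cases "P k") (auto simp: mat_unit_def)
    then show ?thesis
      unfolding p(1) lincomb_index[OF p(2,3)] by (intro sum.cong) auto
  qed
  have "(hs (lincomb N n c y))\<^sup>2 = (\<Sum>p\<in>P ` {..<n}. (cmod (lincomb N n c y $$ p))\<^sup>2)"
    unfolding hs_sq_pairs[OF lincomb_carrier]
  proof (rule sum.mono_neutral_right)
    show "P ` {..<n} \<subseteq> {..<N} \<times> {..<N}" using P by blast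
    show "\<forall>p\<in>{..<N} \<times> {..<N} - P ` {..<n}. (cmod (lincomb N n c y $$ p))\<^sup>2 = 0"
    proof
      fix p assume p: "p \<in> {..<N} \<times> {..<N} - P ` {..<n}"
      then have "P k \<noteq> p" if "k \<in> {..<n}" for k using that by blast
      then have "(\<Sum>k<n. if P k = p then c k else 0) = 0" by (intro sum.neutral ballI if_not_P)
      then show "(cmod (lincomb N n c y $$ p))\<^sup>2 = 0" using entry[of p] p by simp
    qed
  qed simp
  also have "\<dots> = (\<Sum>k<n. (cmod (lincomb N n c y $$ P k))\<^sup>2)"
    by (simp add: sum.reindex[OF injP])
  also have "\<dots> = (\<Sum>k<n. (cmod (c k))\<^sup>2)"
  proof (intro sum.cong refl)
    fix k assume k: "k \<in> {..<n}"
    have "lincomb N n c y $$ P k = (\<Sum>k'<n. if k' = k then c k' else 0)"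
      unfolding entry[OF P[OF k[unfolded lessThan_iff]]]
      using inj_onD[OF injP] k by (intro sum.cong refl if_cong) auto
    then show "(cmod (lincomb N n c y $$ P k))\<^sup>2 = (cmod (c k))\<^sup>2" using k by simp
  qed
  finally have "(hs (lincomb N n c y))\<^sup>2 = (l2 n c)\<^sup>2" by (simp only: l2_sq)
  then show ?thesis by (rule power2_eq_imp_eq) auto
qed

lemma bil_lincomb: "bil (lincomb N n c x) \<xi> \<eta> = (\<Sum>k<n. c k * (\<Sum>i<N. \<Sum>j<N. \<xi> i * x k $$ (i, j) * \<eta> j))"
proof -
  have "bil (lincomb N n c x) \<xi> \<eta> = (\<Sum>i<N. \<Sum>j<N. \<Sum>k<n. c k * (\<xi> i * x k $$ (i, j) * \<eta> j))"
    unfolding bil_def lincomb_dim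
    by (intro sum.cong refl) (simp add: lincomb_index sum_distrib_left sum_distrib_right mult_ac)
  also have "\<dots> = (\<Sum>i<N. \<Sum>k<n. \<Sum>j<N. c k * (\<xi> i * x k $$ (i, j) * \<eta> j))"
    by (rule sum.cong[OF refl], rule sum.swap)
  also have "\<dots> = (\<Sum>k<n. \<Sum>i<N. \<Sum>j<N. c k * (\<xi> i * x k $$ (i, j) * \<eta> j))"
    by (rule sum.swap)
  finally show ?thesis by (simp only: sum_distrib_left)
qed

text \<open>The conjugation turns the bilinear form of a matrix into an inner product with this element.\<close>

definition rank_one :: "nat \<Rightarrow> (nat \<Rightarrow> complex) \<Rightarrow> (nat \<Rightarrow> complex) \<Rightarrow> complex mat" where
  "rank_one N \<xi> \<eta> = mat N N (\<lambda>(i, j). cnj (\<xi> i * \<eta> j))"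

lemma rank_one_carrier [simp]: "rank_one N \<xi> \<eta> \<in> carrier_mat N N"
  by (simp add: rank_one_def)

lemma hs_rank_one: "hs (rank_one N \<xi> \<eta>) = l2 N \<xi> * l2 N \<eta>"
proof -
  have "(hs (rank_one N \<xi> \<eta>))\<^sup>2 = (\<Sum>i<N. \<Sum>j<N. (cmod (\<xi> i))\<^sup>2 * (cmod (\<eta> j))\<^sup>2)"
    unfolding hs_sq[OF rank_one_carrier]
    by (intro sum.cong refl) (simp add: rank_one_def norm_mult power_mult_distrib)
  also have "\<dots> = (l2 N \<xi> * l2 N \<eta>)\<^sup>2"
    by (simp add: power_mult_distrib l2_sq sum_product)
  finally show ?thesis by (rule power2_eq_imp_eq) auto
qed

lemma tr_inner_rank_one:
  assumes "x \<in> carrier_mat N N"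
  shows "tr_inner (rank_one N \<xi> \<eta>) x = bil x \<xi> \<eta>"
proof -
  have "tr_inner (rank_one N \<xi> \<eta>) x = (\<Sum>i<N. \<Sum>j<N. cnj (rank_one N \<xi> \<eta> $$ (i, j)) * x $$ (i, j))"
    by (simp add: tr_inner_eq[OF rank_one_carrier assms] sum.cartesian_product case_prod_unfold)
  also have "\<dots> = bil x \<xi> \<eta>"
    using assms by (auto simp: bil_def rank_one_def mult_ac intro!: sum.cong)
  finally show ?thesis .
qed

lemma opnorm_le_hs_of_net:
  assumes X: "\<And>f. f \<in> X \<Longrightarrow> l2 n f \<le> 1" "\<And>f. l2 n f \<le> 1 \<Longrightarrow> \<exists>f'\<in>X. l2 n (\<lambda>i. f i - f' i) \<le> 1 / 4"
    and Y: "\<And>f. f \<in> Y \<Longrightarrow> l2 N f \<le> 1" "\<And>f. l2 N f \<le> 1 \<Longrightarrow> \<exists>f'\<in>Y. l2 N (\<lambda>i. f i - f' i) \<le> 1 / 4"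
    and t: "0 \<le> t"
    and le: "\<And>c \<xi> \<eta>. c \<in> X \<Longrightarrow> \<xi> \<in> Y \<Longrightarrow> \<eta> \<in> Y \<Longrightarrow> cmod (bil (lincomb N n c x) \<xi> \<eta>) \<le> t"
  shows "opnorm (lincomb N n c x) \<le> 4 * t * l2 n c"
proof (rule opnorm_le)
  fix \<xi> \<eta> :: "nat \<Rightarrow> complex"
  define T where "T c \<xi> \<eta> = bil (lincomb N n c x) \<xi> \<eta>" for c \<xi> \<eta>
  note T = T_def bil_lincomb
  define B where "B = (\<Sum>k<n. \<Sum>i<N. \<Sum>j<N. cmod (x k $$ (i, j)))"
  have coord: "cmod (f i) \<le> 1" if "l2 d f \<le> 1" "i < d" for d f i
    using member_le_L2_set[of "{..<d}" i "\<lambda>i. cmod (f i)"] that by (simp add: l2_def)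
  have "cmod (T c \<xi> \<eta>) \<le> 4 * t * l2 n c * l2 N \<xi> * l2 N \<eta>"
  proof (rule trilinear_net_le[of T, where X = X and Y = Y and Z = Y and B = B])
    fix a b y z
    show "T (\<lambda>i. a i - b i) y z = T a y z - T b y z"
      by (simp add: T left_diff_distrib sum_subtractf)
    show "T y (\<lambda>i. a i - b i) z = T y a z - T y b z"
      by (simp add: T left_diff_distrib right_diff_distrib sum_subtractf)
    show "T y z (\<lambda>i. a i - b i) = T y z a - T y z b"
      by (simp add: T right_diff_distrib sum_subtractf)
  next
    fix s a y z
    show "T (\<lambda>i. s * a i) y z = s * T a y z"
      by (simp add: T sum_distrib_left mult_ac)
    show "T a (\<lambda>i. s * y i) z = s * T a y z"
      by (simp add: T sum_distrib_left mult_ac)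
    show "T a y (\<lambda>i. s * z i) = s * T a y z"
      by (simp add: T sum_distrib_left mult_ac)
  next
    fix a y z assume b: "l2 n a \<le> 1" "l2 N y \<le> 1" "l2 N z \<le> 1"
    have "cmod (T a y z) \<le> (\<Sum>k<n. \<Sum>i<N. \<Sum>j<N. cmod (a k * (y i * x k $$ (i, j) * z j)))"
      unfolding T sum_distrib_left by (intro sum_norm_le order_refl)
    also have "\<dots> \<le> B"
      unfolding B_def
    proof (intro sum_mono)
      fix k i j assume "k \<in> {..<n}" "i \<in> {..<N}" "j \<in> {..<N}"
      then have "cmod (a k) * (cmod (y i) * cmod (z j)) \<le> 1 * (1 * 1)"
        using b by (intro mult_mono coord) auto
      from mult_right_mono[OF this norm_ge_zero[of "x k $$ (i, j)"]]
      show "cmod (a k * (y i * x k $$ (i, j) * z j)) \<le> cmod (x k $$ (i, j))"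
        by (simp add: norm_mult mult_ac)
    qed
    finally show "cmod (T a y z) \<le> B" .
  qed (use X Y le in \<open>auto simp: T_def\<close>)
  then show "cmod (bil (lincomb N n c x) \<xi> \<eta>) \<le> 4 * t * l2 n c
      * l2 (dim_row (lincomb N n c x)) \<xi> * l2 (dim_col (lincomb N n c x)) \<eta>"
    by (simp add: T_def)
qed (use t in simp)

text \<open>The union bound over the nets, with threshold $t = \sqrt{K/N}$. The number of triples is at most
  $(9 \cdot 2^{36})^{3N}$ and each event has probability at most $4 e^{-t^2 N^2 / 8} = 4 e^{-K N / 8}$; both are
  exponential in $N$, so a constant $K$ makes the product small uniformly in $N$. An explicit
  exceptional set is returned because the set where the inequality holds for all $x$ is not evidently
  measurable.\<close>

lemma random_subspace_opnorm_le_hs: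
  assumes \<mu>: "normalized_haar N \<mu>" and N: "0 < N" and nN: "n \<le> N"
    and y: "y ` {..<n} \<subseteq> matrix_units N" and inj: "inj_on y {..<n}" and K: "0 \<le> K"
  obtains B where "B \<in> sets \<mu>" "measure \<mu> B \<le> 4 * ((9 * 2 ^ 36) ^ 3 * exp (- K / 8)) ^ N"
    "\<And>U x. U \<in> space \<mu> \<Longrightarrow> U \<notin> B \<Longrightarrow> x \<in> mat_span N n (\<lambda>k. U (y k)) \<Longrightarrow>
      real N * (opnorm x)\<^sup>2 \<le> 16 * K * (hs x)\<^sup>2"
proof -
  interpret prob_space \<mu> using \<mu> by (simp add: normalized_haar_def)
  have sp: "space \<mu> = unitary_ops N" using \<mu> by (simp add: normalized_haar_def)
  have yc: "y ` {..<n} \<subseteq> carrier_mat N N" using y by (auto simp: matrix_units_def subset_iff)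
  obtain X where X: "finite X" "real (card X) \<le> (9 * 2 ^ 36) ^ N" "\<And>f. f \<in> X \<Longrightarrow> l2 n f \<le> 1"
    "\<And>f. l2 n f \<le> 1 \<Longrightarrow> \<exists>g\<in>X. l2 n (\<lambda>i. f i - g i) \<le> 1 / 4"
    using exists_net[OF N nN] by blast
  obtain Y where Y: "finite Y" "real (card Y) \<le> (9 * 2 ^ 36) ^ N" "\<And>f. f \<in> Y \<Longrightarrow> l2 N f \<le> 1"
    "\<And>f. l2 N f \<le> 1 \<Longrightarrow> \<exists>g\<in>Y. l2 N (\<lambda>i. f i - g i) \<le> 1 / 4"
    using exists_net[OF N order_refl] by blast
  define t where "t = sqrt (K / real N)"
  have t: "0 \<le> t" and Nt: "real N * t\<^sup>2 = K" using K N by (auto simp: t_def)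
  define bad where "bad = (\<lambda>(c, \<xi>, \<eta>).
    {U \<in> space \<mu>. t \<le> cmod (tr_inner (rank_one N \<xi> \<eta>) (U (lincomb N n c y)))})"
  define b where "b = 4 * exp (- K / 8) ^ N"
  have bad_sets: "bad q \<in> sets \<mu>" for q
  proof (cases q)
    case (fields c \<xi> \<eta>)
    show ?thesis
      using haar_measurable_tr_inner[OF \<mu> y rank_one_carrier[of N \<xi> \<eta>], of c]
      unfolding fields bad_def prod.case by measurable
  qed
  have bad_le: "measure \<mu> (bad q) \<le> b" if "q \<in> X \<times> Y \<times> Y" for q
  proof (cases q)
    case (fields c \<xi> \<eta>)
    then have q: "c \<in> X" "\<xi> \<in> Y" "\<eta> \<in> Y" using that by auto
    have "hs (rank_one N \<xi> \<eta>) \<le> 1"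
      unfolding hs_rank_one using Y(3)[OF q(2)] Y(3)[OF q(3)] by (intro mult_le_one) auto
    moreover have "hs (lincomb N n c y) \<le> 1"
      unfolding hs_lincomb_units[OF y inj] by (rule X(3)[OF q(1)])
    ultimately have "measure \<mu> (bad q) \<le> 4 * exp (- (t * N)\<^sup>2 / 8)"
      unfolding fields bad_def prod.case using haar_tail[OF \<mu> N y rank_one_carrier _ _ t] by blast
    also have "(t * real N)\<^sup>2 = K * real N"
      using Nt by (simp add: power2_eq_square mult_ac)
    also have "4 * exp (- (K * real N) / 8) = b"
      by (simp add: b_def exp_of_nat_mult[symmetric] mult_ac)
    finally show ?thesis .
  qed
  have b0: "0 \<le> b" by (simp add: b_def)
  define B where "B = (\<Union>q\<in>X \<times> Y \<times> Y. bad q)"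
  show ?thesis
  proof (rule that[of B])
    show "B \<in> sets \<mu>"
      unfolding B_def using X(1) Y(1) bad_sets by (intro sets.finite_UN) auto
    have "measure \<mu> B \<le> (\<Sum>q\<in>X \<times> Y \<times> Y. measure \<mu> (bad q))"
      unfolding B_def using X(1) Y(1) bad_sets by (intro finite_measure_subadditive_finite) auto
    also have "\<dots> \<le> (\<Sum>q\<in>X \<times> Y \<times> Y. b)" by (rule sum_mono[OF bad_le])
    also have "\<dots> = (real (card X) * (real (card Y) * real (card Y))) * b"
      by (simp add: card_cartesian_product)
    also have "\<dots> \<le> ((9 * 2 ^ 36) ^ N * ((9 * 2 ^ 36) ^ N * (9 * 2 ^ 36) ^ N)) * b"
      using X(2) Y(2) b0 by (intro mult_right_mono mult_mono) auto
    also have "\<dots> = 4 * ((9 * 2 ^ 36) ^ 3 * exp (- K / 8)) ^ N"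
      by (simp only: b_def power3_eq_cube power_mult_distrib mult_ac)
    finally show "measure \<mu> B \<le> 4 * ((9 * 2 ^ 36) ^ 3 * exp (- K / 8)) ^ N" .
  next
    fix U x assume U: "U \<in> space \<mu>" "U \<notin> B" and x: "x \<in> mat_span N n (\<lambda>k. U (y k))"
    from x obtain c where c: "x = lincomb N n c (\<lambda>k. U (y k))" by (auto simp: mat_span_lincomb)
    have Uo: "U \<in> unitary_ops N" using U sp by simp
    have "opnorm x \<le> 4 * t * l2 n c"
      unfolding c
    proof (rule opnorm_le_hs_of_net[OF X(3,4) Y(3,4) t])
      fix c \<xi> \<eta> assume q: "c \<in> X" "\<xi> \<in> Y" "\<eta> \<in> Y"
      then have "U \<notin> bad (c, \<xi>, \<eta>)" using U(2) by (auto simp: B_def)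
      then have "cmod (tr_inner (rank_one N \<xi> \<eta>) (U (lincomb N n c y))) \<le> t"
        using U(1) by (simp add: bad_def)
      then show "cmod (bil (lincomb N n c (\<lambda>k. U (y k))) \<xi> \<eta>) \<le> t"
        by (simp only: unitary_lincomb[OF Uo yc] tr_inner_rank_one[OF lincomb_carrier])
    qed
    moreover have "hs x = l2 n c"
      unfolding c unitary_lincomb[OF Uo yc, symmetric] hs_unitary[OF Uo lincomb_carrier]
      by (rule hs_lincomb_units[OF y inj])
    ultimately have "(opnorm x)\<^sup>2 \<le> (4 * t * hs x)\<^sup>2"
      using opnorm_nonneg by (intro power_mono) auto
    then have "real N * (opnorm x)\<^sup>2 \<le> real N * (4 * t * hs x)\<^sup>2"
      by (intro mult_left_mono) auto
    also have "\<dots> = 16 * (real N * t\<^sup>2) * (hs x)\<^sup>2" by (simp add: power_mult_distrib)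
    finally show "real N * (opnorm x)\<^sup>2 \<le> 16 * K * (hs x)\<^sup>2" by (simp only: Nt)
  qed
qed

theorem corollary2p2:
  fixes \<delta> :: real
  assumes "0 < \<delta>" and "\<delta> < 1"
  shows "\<exists>C::real. 0 \<le> C \<and>
    (\<forall>(N::nat) (n::nat) (\<mu> :: (complex mat \<Rightarrow> complex mat) measure) (y :: nat \<Rightarrow> complex mat).
       n \<le> N \<longrightarrow> normalized_haar N \<mu> \<longrightarrow>
       inj_on y {..<n} \<longrightarrow> y ` {..<n} \<subseteq> matrix_units N \<longrightarrow>
       measure \<mu> {U \<in> space \<mu>.
           pi_1cb N (mat_span N n (\<lambda>k. U (y k))) opnorm id \<le> ennreal C} \<ge> 1 - \<delta>)"
proof -
  define A :: real where "A = (9 * 2 ^ 36) ^ 3"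
  define K where "K = 8 * ln (4 * A / \<delta>)"
  have A: "1 \<le> A" by (simp add: A_def)
  have K: "0 \<le> K" using A assms by (simp add: K_def)
  \<comment> \<open>The choice of $K$: the exceptional probability is at most $4 (\delta/4)^N \le \delta$ for $N \ge 1$.\<close>
  have base: "A * exp (- K / 8) = \<delta> / 4"
    using A assms by (simp add: K_def exp_minus)
  show ?thesis
  proof (intro exI[of _ "16 * K"] conjI allI impI)
    show "0 \<le> 16 * K" using K by simp
    fix N n :: nat and \<mu> :: "(complex mat \<Rightarrow> complex mat) measure" and y :: "nat \<Rightarrow> complex mat"
    assume nN: "n \<le> N" and \<mu>: "normalized_haar N \<mu>" and inj: "inj_on y {..<n}"
      and y: "y ` {..<n} \<subseteq> matrix_units N"
    interpret prob_space \<mu> using \<mu> by (simp add: normalized_haar_def)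
    define G where "G = {U \<in> space \<mu>. pi_1cb N (mat_span N n (\<lambda>k. U (y k))) opnorm id \<le> ennreal (16 * K)}"
    have G: "G \<in> sets \<mu>" unfolding G_def by (rule pi_1cb_sets[OF \<mu> y]) (use K in simp)
    have good: "U \<in> G" if "U \<in> space \<mu>" "\<And>x. x \<in> mat_span N n (\<lambda>k. U (y k)) \<Longrightarrow>
        real N * (opnorm x)\<^sup>2 \<le> 16 * K * (hs x)\<^sup>2" for U
      unfolding G_def using that K by (auto intro!: pi_1cb_le_of_opnorm_le_hs mat_span_carrier)
    have "1 - \<delta> \<le> measure \<mu> G"
    proof (cases "N = 0")
      case True
      then have "space \<mu> \<subseteq> G" using good K by (intro subsetI good) auto
      then have "measure \<mu> (space \<mu>) \<le> measure \<mu> G" by (intro finite_measure_mono G)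
      then show ?thesis using assms by (simp add: prob_space)
    next
      case False
      then have N: "0 < N" by simp
      obtain B where B: "B \<in> sets \<mu>" "measure \<mu> B \<le> 4 * (A * exp (- K / 8)) ^ N"
        "\<And>U x. U \<in> space \<mu> \<Longrightarrow> U \<notin> B \<Longrightarrow> x \<in> mat_span N n (\<lambda>k. U (y k)) \<Longrightarrow>
          real N * (opnorm x)\<^sup>2 \<le> 16 * K * (hs x)\<^sup>2"
        using random_subspace_opnorm_le_hs[OF \<mu> N nN y inj K] unfolding A_def by metis
      have "(\<delta> / 4) ^ N \<le> (\<delta> / 4) ^ 1"
        using assms N by (intro power_decreasing) auto
      then have "measure \<mu> B \<le> \<delta>" using B(2) unfolding base by simp
      then have "1 - \<delta> \<le> measure \<mu> (space \<mu> - B)" by (simp add: prob_compl[OF B(1)])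
      also have "\<dots> \<le> measure \<mu> G"
        using B(3) good G by (intro finite_measure_mono subsetI) auto
      finally show ?thesis .
    qed
    then show "1 - \<delta> \<le> measure \<mu> {U \<in> space \<mu>.
        pi_1cb N (mat_span N n (\<lambda>k. U (y k))) opnorm id \<le> ennreal (16 * K)}"
      by (simp only: G_def)
  qed
qed

end
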